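(* Let $d\ge2$ and let $\zeta\in\mathbb{C}$ be a primitive $d$-th root of unity. Then $\ker\rho_\zeta=N_d$ and $P_\zeta=\langle R\rangle N_d$. Equivalently, the homomorphism $\bar\rho_\zeta\colon\Delta_d\to\mathrm{PGL}(2,\mathbb{C})$ induced by $\rho_\zeta$ is injective, and the stabilizer of $\infty$ in $\bar\rho_\zeta(\Delta_d)$ is generated by $\bar\rho_\zeta(t)$.
   Context: $\Gamma=\mathrm{PSL}(2,\mathbb{Z})$; $R$ and $S$ are the images in $\Gamma$ of $\begin{pmatrix}1&1\\0&1\end{pmatrix}$ and $\begin{pmatrix}0&-1\\1&0\end{pmatrix}$. $\Gamma$ has the presentation $\langle S,R\mid S^2,(SR)^3\rangle$. For $\zeta\in\mathbb{C}^\times$, $\rho_\zeta\colon\Gamma\to\mathrm{PGL}(2,\mathbb{C})$ is the homomorphism sending $R$ and $S$ to the classes of $R_\zeta=\begin{pmatrix}\zeta&1\\0&1\end{pmatrix}$ and $S_\zeta=\begin{pmatrix}0&-\zeta^{-1}\\1&0\end{pmatrix}$ (it is well defined). $\mathrm{PGL}(2,\mathbb{C})$ acts on $\mathbb{P}^1(\mathbb{C})=\mathbb{C}\cup\{\infty\}$ by M\"obius transformations, and $P_\zeta=\{\gamma\in\Gamma\mid\rho_\zeta(\gamma)(\infty)=\infty\}$. $N_d$ is the normal closure of $R^d$ in $\Gamma$, $\Delta_d=\Gamma/N_d$, and $t$ is the image of $R$ in $\Delta_d$. If $\zeta$ is a primitive $d$-th root of unity then $N_d\subset\ker\rho_\zeta$,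 so $\rho_\zeta$ induces $\bar\rho_\zeta$ on $\Delta_d$. *)

theory Defs
  imports "HOL-Analysis.Analysis" "HOL-Algebra.Algebra"
begin

definition SL2Z :: "(int^2^2) monoid" where
  "SL2Z = \<lparr>carrier = {A. det A = 1}, monoid.mult = (**), one = mat 1\<rparr>"

definition PSL2Z :: "(int^2^2) set monoid" where
  "PSL2Z = SL2Z Mod {mat 1, - mat 1}"

definition GL2C :: "(complex^2^2) monoid" where
  "GL2C = \<lparr>carrier = {A. invertible A}, monoid.mult = (**), one = mat 1\<rparr>"

definition scalars2C :: "(complex^2^2) set" where
  "scalars2C = {mat c | c. c \<noteq> 0}"

definition PGL2C :: "(complex^2^2) set monoid" where
  "PGL2C = GL2C Mod scalars2C"

definition psl_class :: "int^2^2 \<Rightarrow> (int^2^2) set" where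
  "psl_class A = {mat 1, - mat 1} #>\<^bsub>SL2Z\<^esub> A"

definition pgl_class :: "complex^2^2 \<Rightarrow> (complex^2^2) set" where
  "pgl_class A = scalars2C #>\<^bsub>GL2C\<^esub> A"

text \<open>\<^const>\<open>vector\<close> lists the rows of a matrix.\<close>

definition R_elt :: "(int^2^2) set" where
  "R_elt = psl_class (vector [vector [1, 1], vector [0, 1]])"

definition S_elt :: "(int^2^2) set" where
  "S_elt = psl_class (vector [vector [0, -1], vector [1, 0]])"

definition R_mat :: "complex \<Rightarrow> complex^2^2" where
  "R_mat \<zeta> = vector [vector [\<zeta>, 1], vector [0, 1]]"

definition S_mat :: "complex \<Rightarrow> complex^2^2" where
  "S_mat \<zeta> = vector [vector [0, - inverse \<zeta>], vector [1, 0]]"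

text \<open>For \<open>\<zeta> \<noteq> 0\<close> there is exactly one homomorphism as in the following definition:
  \<^const>\<open>S_elt\<close> and \<^const>\<open>R_elt\<close> generate \<^const>\<open>PSL2Z\<close> with defining relations
  \<open>S\<^sup>2 = (SR)\<^sup>3 = 1\<close>, and these relations also hold for the classes of \<^term>\<open>S_mat \<zeta>\<close> and
  \<^term>\<open>R_mat \<zeta>\<close>. Extensionality only fixes the values outside the carrier.\<close>

definition rho :: "complex \<Rightarrow> (int^2^2) set \<Rightarrow> (complex^2^2) set" where
  "rho \<zeta> = (THE \<phi>. \<phi> \<in> hom PSL2Z PGL2C \<and> \<phi> \<in> extensional (carrier PSL2Z) \<and>
      \<phi> R_elt = pgl_class (R_mat \<zeta>) \<and> \<phi> S_elt = pgl_class (S_mat \<zeta>))"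

datatype cp1 = Fin complex | Infinity

fun moebius :: "complex^2^2 \<Rightarrow> cp1 \<Rightarrow> cp1" where
  "moebius A (Fin z) =
     (if A$2$1 * z + A$2$2 = 0 then Infinity
      else Fin ((A$1$1 * z + A$1$2) / (A$2$1 * z + A$2$2)))"
| "moebius A Infinity = (if A$2$1 = 0 then Infinity else Fin (A$1$1 / A$2$1))"

text \<open>All representatives of an element of \<^const>\<open>PGL2C\<close> act in the same way, so the image
  below is a singleton.\<close>

definition pgl_act :: "(complex^2^2) set \<Rightarrow> cp1 \<Rightarrow> cp1" where
  "pgl_act M z = the_elem ((\<lambda>A. moebius A z) ` M)"

definition P_stab :: "complex \<Rightarrow> (int^2^2) set set" where
  "P_stab \<zeta> = stabilizer PSL2Z (\<lambda>\<gamma>. pgl_act (rho \<zeta> \<gamma>)) Infinity"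

definition normal_closure :: "('a, 'b) monoid_scheme \<Rightarrow> 'a set \<Rightarrow> 'a set" where
  "normal_closure G A = \<Inter> {N. N \<lhd> G \<and> A \<subseteq> N}"

definition N_sub :: "nat \<Rightarrow> (int^2^2) set set" where
  "N_sub d = normal_closure PSL2Z {R_elt [^]\<^bsub>PSL2Z\<^esub> d}"

definition Delta :: "nat \<Rightarrow> (int^2^2) set set monoid" where
  "Delta d = PSL2Z Mod N_sub d"

definition t_elt :: "nat \<Rightarrow> (int^2^2) set set" where
  "t_elt d = N_sub d #>\<^bsub>PSL2Z\<^esub> R_elt"

text \<open>The map induced on cosets, as in the library's first isomorphism theorem:
  it is well defined on \<^term>\<open>Delta d\<close> whenever \<^term>\<open>N_sub d\<close> lies in the kernel of
  \<^term>\<open>rho \<zeta>\<close>.\<close>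

definition rho_bar :: "complex \<Rightarrow> (int^2^2) set set \<Rightarrow> (complex^2^2) set" where
  "rho_bar \<zeta> C = the_elem (rho \<zeta> ` C)"

definition primitive_root_of_unity :: "nat \<Rightarrow> complex \<Rightarrow> bool" where
  "primitive_root_of_unity d \<zeta> \<longleftrightarrow>
     d > 0 \<and> \<zeta> ^ d = 1 \<and> (\<forall>k. 0 < k \<and> k < d \<longrightarrow> \<zeta> ^ k \<noteq> 1)"

end

(* Let z = exp(2 pi i / d). The transformations R_z and S_z are products of pairs of the three
antiholomorphic reflections w -> 1 - cnj w, w -> - cnj z * cnj w and w -> 1 / cnj w. These satisfy
the relations of the Coxeter group W of type (2,3,d), so Delta_d is its even subgroup. The line
spanned by (1,0) gives the rank one Hermitian form of the point at infinity, and three real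
functionals of that form transform under the reflections exactly like a fundamental weight in the
dual of the geometric representation of W. An invariant Hermitian form excludes a nontrivial scaling.
Hence an element fixing infinity fixes that weight, and by Tits's theorem (roots are positive or
negative) it lies in the dihedral parabolic subgroup, whose even part is generated by t. This is the
stabilizer, and faithfulness follows since t has order d on both sides.
The case d = infinity, z = 1 of the same argument is the presentation of PSL(2,Z), which gives the
existence of rho. Another primitive d-th root of unity is a Galois conjugate of z, and fixing
infinity is the vanishing of an integer polynomial in the root of unity. *)

theory Submission
  imports Defs
begin

text \<open>Tits's theorem needs the angle between the first two mirrors to be exactly pi / d.
  Another primitive root of unity turns it into a multiple of pi / d, for which roots can have mixed
  signs; so the geometric argument is run for one root, and only its hypothesis, a polynomial
  equation, is transferred. The stabilizer comes before the kernel because fixing infinity is a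
  single such equation and corresponds to fixing a weight. All computations are done with words in
  the three reflections. A word can be evaluated over the complex numbers, over the integers or in
  the Coxeter group before any presentation is known, and the existence of \<open>rho\<close> is a
  comparison of these evaluations. Since the reflections are antiholomorphic, complex evaluation
  conjugates at each letter, and even words are the ones that represent elements of the modular
  group.\<close>

hide_const (open) Module.smult UnivPoly.monom UnivPoly.coeff Polynomials.degree Polynomials.lead_coeff
  Divisibility.prime

section \<open>Tits's theorem on Coxeter groups\<close>

text \<open>The value \<open>m i j = 0\<close> encodes an infinite order of \<open>ij\<close>.\<close>

locale coxeter =
  fixes m :: "'n::finite \<Rightarrow> 'n \<Rightarrow> nat"
  assumes m_diag: "m i i = 1"
    and m_off: "i \<noteq> j \<Longrightarrow> m i j \<noteq> 1"
    and m_sym: "m i j = m j i"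
begin

text \<open>Two words are related if they represent the same element of the Coxeter group; for \<open>i = j\<close> the
  rule \<open>rel\<close> says that \<open>i\<close> is an involution, and for \<open>m i j = 0\<close> it is void.\<close>

inductive cox_eq :: "'n list \<Rightarrow> 'n list \<Rightarrow> bool" (infix \<open>\<bumpeq>\<close> 50) where
  refl [simp, intro]: "w \<bumpeq> w"
| sym: "w \<bumpeq> w' \<Longrightarrow> w' \<bumpeq> w"
| trans [trans]: "u \<bumpeq> v \<Longrightarrow> v \<bumpeq> w \<Longrightarrow> u \<bumpeq> w"
| rel: "u @ concat (replicate (m i j) [i, j]) @ v \<bumpeq> u @ v"

lemma cox_context: "w \<bumpeq> w' \<Longrightarrow> u @ w @ v \<bumpeq> u @ w' @ v"
proof (induction rule: cox_eq.induct)
  case (rel x i j y)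
  show ?case using cox_eq.rel[of "u @ x" i j "y @ v"] by simp
qed (auto intro: cox_eq.sym cox_eq.trans)

lemma append_cong: "u \<bumpeq> u' \<Longrightarrow> v \<bumpeq> v' \<Longrightarrow> u @ v \<bumpeq> u' @ v'"
  using cox_context[of u u' "[]" v] cox_context[of v v' u' "[]"] by (auto intro: cox_eq.trans)

lemma cancel: "u @ i # i # v \<bumpeq> u @ v"
  using cox_eq.rel[of u i i v] by (simp add: m_diag)

lemma move_letter: "u @ [i] \<bumpeq> v \<Longrightarrow> u \<bumpeq> v @ [i]"
  using append_cong[of "u @ [i]" v "[i]" "[i]"] cancel[of u i "[]"]
  by (auto intro: cox_eq.sym cox_eq.trans)

lemma rev_concat_replicate: "rev (concat (replicate k [i, j])) = concat (replicate k [j, i])"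
proof (induction k)
  case (Suc k)
  have "concat (replicate k [j, i]) @ [j, i] = [j, i] @ concat (replicate k [j, i])"
    by (induction k) auto
  with Suc show ?case by simp
qed simp

lemma rev_cong: "w \<bumpeq> w' \<Longrightarrow> rev w \<bumpeq> rev w'"
proof (induction rule: cox_eq.induct)
  case (rel x i j y)
  show ?case using cox_eq.rel[of "rev y" j i "rev x"]
    by (simp add: rev_concat_replicate m_sym)
qed (auto intro: cox_eq.sym cox_eq.trans)

text \<open>Every relator, the square of a letter included, has even length, so the sign
  homomorphism of the Coxeter group exists.\<close>

lemma parity: "w \<bumpeq> w' \<Longrightarrow> even (length w) = even (length w')"
  by (induction rule: cox_eq.induct) (auto simp: length_concat sum_list_replicate)

section \<open>Coxeter length and alternating words\<close>

definition len :: "'n list \<Rightarrow> nat" where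
  "len w = (LEAST k. \<exists>w'. w \<bumpeq> w' \<and> length w' = k)"

lemma len_witness: obtains w' where "w \<bumpeq> w'" "length w' = len w"
  using LeastI_ex[of "\<lambda>k. \<exists>w'. w \<bumpeq> w' \<and> length w' = k"] unfolding len_def by blast

lemma len_le: "w \<bumpeq> w' \<Longrightarrow> len w \<le> length w'"
  unfolding len_def by (rule Least_le) blast

lemma len_cong: "w \<bumpeq> w' \<Longrightarrow> len w = len w'"
  by (metis len_le len_witness order_antisym cox_eq.sym cox_eq.trans)

lemma len_rev: "len (rev w) = len w"
proof -
  have "len (rev w) \<le> len w" for w
    by (metis len_le len_witness length_rev rev_cong)
  from this[of w] this[of "rev w"] show ?thesis by simp
qed

text \<open>The word grows at its left end and always ends in \<open>t\<close>, because Tits's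
  argument strips letters from the right of a reduced word.\<close>

fun alt :: "nat \<Rightarrow> 'n \<Rightarrow> 'n \<Rightarrow> 'n list" where
  "alt 0 s t = []"
| "alt (Suc k) s t = (if even k then t else s) # alt k s t"

lemma length_alt [simp]: "length (alt k s t) = k"
  by (induction k) auto

lemma alt_snoc: "alt (Suc k) s t = alt k t s @ [t]"
  by (induction k) auto

lemma alt_split: "\<exists>y. length y = j \<and> alt (j + k) s t = y @ alt k s t"
proof (induction j)
  case (Suc j)
  then obtain y where "length y = j" "alt (j + k) s t = y @ alt k s t" by blast
  then show ?case
    by (intro exI[of _ "(if even (j + k) then t else s) # y"]) auto
qed simp

lemma alt_double: "alt (2 * k) s t = concat (replicate k [s, t])"
  by (induction k) auto

text \<open>Moves letters of the relation \<open>(st)\<^sup>m = 1\<close> to the other side one at a time; \<open>j = m s t\<close> is the braid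
  relation.\<close>

lemma alt_complement: "j \<le> 2 * m s t \<Longrightarrow> alt j s t \<bumpeq> alt (2 * m s t - j) t s"
proof (induction j arbitrary: s t)
  case 0
  show ?case using cox_eq.rel[of "[]" t s "[]"] m_sym[of t s]
    by (auto simp: alt_double intro: cox_eq.sym)
next
  case (Suc j)
  then obtain l where l: "2 * m s t - j = Suc l" by (cases "2 * m s t - j") auto
  have "alt (Suc j) s t = alt j t s @ [t]" by (rule alt_snoc)
  also have "\<dots> \<bumpeq> alt (Suc l) s t @ [t]"
    using Suc.IH[of t s] Suc.prems l m_sym[of t s] by (intro append_cong) auto
  also have "alt (Suc l) s t @ [t] = alt l t s @ [t, t]"
    unfolding alt_snoc by simp
  also have "\<dots> \<bumpeq> alt l t s" using cancel[of _ t "[]"] by simp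
  also have "l = 2 * m s t - Suc j" using l by simp
  finally show ?case .
qed

lemma braid: "alt (m s t) s t \<bumpeq> alt (m s t) t s"
  using alt_complement[of "m s t" s t] by simp

section \<open>The geometric representation and its dual\<close>

definition cartan :: "'n \<Rightarrow> real^'n" where
  "cartan i = (\<chi> j. if m i j = 0 then - 2 else - 2 * cos (pi / m i j))"

definition reflect :: "'n \<Rightarrow> real^'n \<Rightarrow> real^'n" where
  "reflect i v = v - (cartan i \<bullet> v) *\<^sub>R axis i 1"

text \<open>The contragredient of \<open>reflect\<close>: \<open>axis i 1\<close> is the simple root
  of \<open>i\<close>, and \<open>y $ i\<close> is the value of the functional \<open>y\<close> on
  it. The vectors with nonnegative coordinates form the closed fundamental chamber.\<close>

definition dual_reflect :: "'n \<Rightarrow> real^'n \<Rightarrow> real^'n" where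
  "dual_reflect i y = y - (y $ i) *\<^sub>R cartan i"

abbreviation act :: "'n list \<Rightarrow> real^'n \<Rightarrow> real^'n" where
  "act \<equiv> foldr reflect"

abbreviation dual_act :: "'n list \<Rightarrow> real^'n \<Rightarrow> real^'n" where
  "dual_act \<equiv> foldr dual_reflect"

lemma cartan_self [simp]: "cartan i $ i = 2"
  by (simp add: cartan_def m_diag)

lemma cartan_sym: "cartan i $ j = cartan j $ i"
  by (simp add: cartan_def m_sym)

lemma dual_reflect_inner: "dual_reflect i y \<bullet> v = y \<bullet> reflect i v"
  by (simp add: dual_reflect_def reflect_def inner_diff_left inner_diff_right inner_axis)

lemma dual_act_inner: "dual_act w y \<bullet> v = y \<bullet> act (rev w) v"
  by (induction w arbitrary: v) (auto simp: dual_reflect_inner)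

lemma linear_reflect: "linear (reflect i)"
  by (rule linearI) (auto simp: reflect_def algebra_simps inner_add_right)

lemma linear_act: "linear (act w)"
proof (induction w)
  case (Cons i w)
  then show ?case
    using linear_compose[OF Cons linear_reflect[of i]] by (simp add: o_def)
qed (simp add: linear_ident id_def)

lemma reflect_involution [simp]: "reflect i (reflect i v) = v"
  by (simp add: reflect_def inner_diff_right inner_axis)

lemma reflect_axis_self [simp]: "reflect i (axis i 1) = - axis i 1"
  by (simp add: reflect_def inner_axis scaleR_2)

lemma dual_reflect_involution [simp]: "dual_reflect i (dual_reflect i y) = y"
  by (simp add: dual_reflect_def)

lemma reflect_comb:
  assumes "s \<noteq> t"
  shows "reflect t (x *\<^sub>R axis s 1 + y *\<^sub>R axis t 1)
    = x *\<^sub>R axis s 1 + (- cartan s $ t * x - y) *\<^sub>R axis t 1"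
proof -
  have "cartan t \<bullet> (x *\<^sub>R axis s 1 + y *\<^sub>R axis t 1) = cartan s $ t * x + 2 * y"
    by (simp add: inner_add_right inner_axis cartan_sym[of t s])
  then have "reflect t (x *\<^sub>R axis s 1 + y *\<^sub>R axis t 1)
    = x *\<^sub>R axis s 1 + (y *\<^sub>R axis t 1 - (cartan s $ t * x + 2 * y) *\<^sub>R axis t 1)"
    by (simp add: reflect_def)
  also have "y *\<^sub>R axis t 1 - (cartan s $ t * x + 2 * y) *\<^sub>R axis t 1
    = (- cartan s $ t * x - y) *\<^sub>R axis t 1"
    unfolding scaleR_diff_left[symmetric] by simp
  finally show ?thesis .
qed

text \<open>Up to the factor \<open>sin (pi / k)\<close> these are the coefficients of the roots of the dihedral group of
  order \<open>2 k\<close>.\<close>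

definition cheb :: "nat \<Rightarrow> nat \<Rightarrow> real" where
  "cheb k j = (if k = 0 then real j else sin (j * pi / k))"

lemma cheb_0 [simp]: "cheb k 0 = 0"
  by (simp add: cheb_def)

lemma cheb_rec: "cheb (m s t) (Suc (Suc j)) = - cartan s $ t * cheb (m s t) (Suc j) - cheb (m s t) j"
proof (cases "m s t = 0")
  case False
  define \<theta> where "\<theta> = pi / m s t"
  have "sin (j * \<theta> + 2 * \<theta>) = 2 * cos \<theta> * sin (j * \<theta> + \<theta>) - sin (j * \<theta>)"
    using sin_add[of "j * \<theta> + \<theta>" \<theta>] sin_diff[of "j * \<theta> + \<theta>" \<theta>]
    by (simp add: algebra_simps)
  then show ?thesis using False
    by (simp add: cheb_def cartan_def \<theta>_def algebra_simps add_divide_distrib)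
qed (simp add: cheb_def cartan_def)

lemma cheb_nonneg:
  assumes "m s t = 0 \<or> j \<le> m s t"
  shows "0 \<le> cheb (m s t) j"
  using assms by (auto simp: cheb_def field_simps intro!: sin_ge_zero)

text \<open>Each letter replaces the coefficient of its own simple root by the next value of the
  recursion, so the two coefficients stay consecutive values of \<open>cheb\<close>.\<close>

lemma act_alt:
  assumes "s \<noteq> t"
  shows "act (alt k s t) (cheb (m s t) (Suc j) *\<^sub>R axis s 1 + cheb (m s t) j *\<^sub>R axis t 1)
    = (if even k then cheb (m s t) (Suc (j + k)) *\<^sub>R axis s 1 + cheb (m s t) (j + k) *\<^sub>R axis t 1
       else cheb (m s t) (j + k) *\<^sub>R axis s 1 + cheb (m s t) (Suc (j + k)) *\<^sub>R axis t 1)"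
proof (induction k)
  case (Suc k)
  have 1: "reflect t (cheb (m s t) (Suc (j + k)) *\<^sub>R axis s 1 + cheb (m s t) (j + k) *\<^sub>R axis t 1)
    = cheb (m s t) (Suc (j + k)) *\<^sub>R axis s 1 + cheb (m s t) (Suc (Suc (j + k))) *\<^sub>R axis t 1"
    unfolding cheb_rec by (rule reflect_comb[OF assms])
  have 2: "reflect s (cheb (m s t) (j + k) *\<^sub>R axis s 1 + cheb (m s t) (Suc (j + k)) *\<^sub>R axis t 1)
    = cheb (m s t) (Suc (Suc (j + k))) *\<^sub>R axis s 1 + cheb (m s t) (Suc (j + k)) *\<^sub>R axis t 1"
    using reflect_comb[OF assms[symmetric], of "cheb (m s t) (Suc (j + k))" "cheb (m s t) (j + k)"]
    unfolding cheb_rec by (simp add: cartan_sym[of t s] add.commute)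
  show ?case using Suc.IH 1 2 by simp
qed simp

lemma cheb_one_pos: "s \<noteq> t \<Longrightarrow> 0 < cheb (m s t) 1"
  using m_off[of s t] by (auto simp: cheb_def field_simps intro!: sin_gt_zero)

text \<open>For finite order the form is nondegenerate on the plane of the two simple roots. So
  \<open>v\<close> splits into a part in this plane, where the sine has period 2 pi, and a part
  killed by both rows of the Cartan matrix, which both reflections fix.\<close>

lemma act_relation: "act (concat (replicate (m s t) [s, t])) v = v"
proof -
  consider "s = t" | "m s t = 0" | "s \<noteq> t" "m s t \<noteq> 0" by blast
  then show ?thesis
  proof cases
    case 3
    define k where "k = m s t"
    have k: "2 \<le> k" using m_off[of s t] 3 by (simp add: k_def)
    define \<theta> where "\<theta> = pi / k"
    have \<theta>: "k * \<theta> = pi" using k by (simp add: \<theta>_def)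
    have pos: "0 < cheb k 1" using cheb_one_pos 3 by (simp add: k_def)
    define F where "F = act (alt (2 * k) s t)"
    have lin: "linear F" by (simp add: F_def linear_act)
    have per: "cheb k (j + 2 * k) = cheb k j" for j
    proof -
      have "real (j + 2 * k) * pi / k = real j * pi / k + 2 * pi"
        using k by (simp add: field_simps)
      then show ?thesis using k by (simp add: cheb_def sin_periodic)
    qed
    have ev: "F (cheb k (Suc j) *\<^sub>R axis s 1 + cheb k j *\<^sub>R axis t 1)
       = cheb k (Suc j) *\<^sub>R axis s 1 + cheb k j *\<^sub>R axis t 1" for j
      using act_alt[of s t "2 * k" j] 3 per[of "Suc j"] per[of j] by (simp add: k_def F_def)
    have Fs: "F (axis s 1) = axis s 1"
    proof -
      have "cheb k 1 *\<^sub>R F (axis s 1) = cheb k 1 *\<^sub>R axis s 1"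
        using ev[of 0] linear_scale[OF lin] by simp
      with pos show ?thesis by simp
    qed
    have Ft: "F (axis t 1) = axis t 1"
    proof -
      \<comment> \<open>At index \<open>k - 1\<close> the pair of coefficients is 0 and
        \<open>cheb k 1\<close>, a multiple of the second simple root.\<close>
      have "cheb k k = 0" "cheb k (k - 1) = cheb k 1"
        using k by (auto simp: cheb_def of_nat_diff field_simps sin_diff)
          (simp add: diff_divide_distrib sin_diff)
      then have "cheb k 1 *\<^sub>R F (axis t 1) = cheb k 1 *\<^sub>R axis t 1"
        using ev[of "k - 1"] linear_scale[OF lin] k by simp
      with pos show ?thesis by simp
    qed
    define c where "c = cartan s $ t"
    have c: "c = - 2 * cos \<theta>" using 3 by (simp add: c_def cartan_def \<theta>_def k_def)
    have "c\<^sup>2 + (2 * sin \<theta>)\<^sup>2 = 4"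
      unfolding c by (simp add: power_mult_distrib sin_squared_eq)
    moreover have "0 < sin \<theta>" using pos k by (simp add: cheb_def \<theta>_def)
    ultimately have D: "4 - c\<^sup>2 \<noteq> 0" by (auto simp: power_mult_distrib)
    define p q where "p = cartan s \<bullet> v" and "q = cartan t \<bullet> v"
    \<comment> \<open>Cramer's rule for the coefficients of the component of \<open>v\<close> in the
      plane; the determinant is 4 times the squared sine.\<close>
    define x y where "x = (2 * p - c * q) / (4 - c\<^sup>2)" and "y = (2 * q - c * p) / (4 - c\<^sup>2)"
    have xy: "2 * x + c * y = p" "c * x + 2 * y = q"
      using D by (simp_all add: x_def y_def divide_simps) (simp_all add: algebra_simps power2_eq_square)
    define z where "z = v - x *\<^sub>R axis s 1 - y *\<^sub>R axis t 1"
    have zs: "reflect s z = z" and zt: "reflect t z = z"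
      using xy by (simp_all add: reflect_def z_def inner_diff_right inner_axis cartan_sym[of t s]
          flip: c_def p_def q_def) (simp_all add: algebra_simps)
    have "act (alt j s t) z = z" for j
      by (induction j) (auto simp: zs zt)
    then have Fz: "F z = z" by (simp add: F_def)
    have "v = x *\<^sub>R axis s 1 + y *\<^sub>R axis t 1 + z" by (simp add: z_def)
    then have "F v = v"
      using Fs Ft Fz by (simp add: linear_add[OF lin] linear_scale[OF lin])
    then show ?thesis by (simp add: F_def alt_double k_def)
  qed (auto simp: m_diag)
qed

lemma act_cong: "w \<bumpeq> w' \<Longrightarrow> act w v = act w' v"
  by (induction arbitrary: v rule: cox_eq.induct) (auto simp: act_relation)

lemma dual_act_cong:
  assumes "w \<bumpeq> w'"
  shows "dual_act w y = dual_act w' y"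
proof -
  have "dual_act w y \<bullet> v = dual_act w' y \<bullet> v" for v
    by (simp add: dual_act_inner act_cong[OF rev_cong[OF assms]])
  then show ?thesis by (metis vector_eq_rdot)
qed

text \<open>Tits's argument: split off from the right of a reduced word for \<open>w\<close> the longest possible alternating
  word in \<open>s\<close> and its last letter \<open>t\<close>. The remaining factor \<open>v\<close> is shortened neither by \<open>s\<close> nor by
  \<open>t\<close>, so induction applies to it, and the alternating word maps the simple root of \<open>s\<close> to a
  nonnegative combination of the simple roots of \<open>s\<close> and \<open>t\<close>.\<close>

theorem root_nonneg:
  assumes "len w \<le> len (w @ [s])"
  shows "0 \<le> act w (axis s 1) $ i"
  using assms
proof (induction "len w" arbitrary: w s i rule: less_induct)
  case less
  obtain w' where w': "w \<bumpeq> w'" "length w' = len w" by (rule len_witness)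
  show ?case
  proof (cases w' rule: rev_cases)
    case Nil
    with act_cong[OF w'(1)] show ?thesis by (simp add: axis_def)
  next
    case (snoc w0 t)
    \<comment> \<open>\<open>A k\<close>: some reduced expression of \<open>w\<close> ends in the
      alternating word of length \<open>k\<close>.\<close>
    define A where "A k \<longleftrightarrow> (\<exists>v. w \<bumpeq> v @ alt k s t \<and> length v + k = len w)" for k
    have "w @ [t] \<bumpeq> w0"
      using append_cong[OF w'(1), of "[t]" "[t]"] cancel[of w0 t "[]"] snoc by (auto intro: cox_eq.trans)
    then have "len (w @ [t]) < len w" using len_le[of "w @ [t]" w0] w' snoc by simp
    with less.prems have "s \<noteq> t" by auto
    have "A 1" using w' snoc unfolding A_def by auto
    moreover have "\<forall>k. A k \<longrightarrow> k \<le> len w" by (auto simp: A_def)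
    ultimately obtain k where "A k" and max: "\<And>j. A j \<Longrightarrow> j \<le> k" and "1 \<le> k"
      by (metis GreatestI_nat Greatest_le_nat)
    then obtain v where v: "w \<bumpeq> v @ alt k s t" "length v + k = len w" by (auto simp: A_def)
    \<comment> \<open>A letter that shortens \<open>v\<close> either continues the alternating word
      to the left, against the maximality of \<open>k\<close>, or cancels its first letter, against
      the minimality of \<open>len w\<close>.\<close>
    have lv: "len v \<le> len (v @ [x])" if "x \<in> {s, t}" for x
    proof (rule ccontr)
      assume "\<not> len v \<le> len (v @ [x])"
      then have less: "len (v @ [x]) < length v" using len_le[of v v] by simp
      obtain v' where v': "v @ [x] \<bumpeq> v'" "length v' = len (v @ [x])" by (rule len_witness)
      show False
      proof (cases "x = (if even k then t else s)")
        case True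
        have "w \<bumpeq> (v' @ [x]) @ alt k s t"
          using v(1) append_cong[OF move_letter[OF v'(1)] cox_eq.refl] by (rule cox_eq.trans)
        then have *: "w \<bumpeq> v' @ alt (Suc k) s t" using True by simp
        then have "len w \<le> length v' + Suc k" using len_le by fastforce
        with * v(2) v'(2) less have "A (Suc k)" unfolding A_def by auto
        then show False using max by force
      next
        case False
        obtain l where l: "k = Suc l" using \<open>1 \<le> k\<close> by (cases k) auto
        have "w \<bumpeq> (v @ [x]) @ alt l s t"
          using v(1) False that l by (auto split: if_splits)
        also have "\<dots> \<bumpeq> v' @ alt l s t" using append_cong[OF v'(1) cox_eq.refl] .
        finally have "len w \<le> length v' + l" using len_le by fastforce
        then show False using v(2) v'(2) less l by simp
      qed
    qed
    \<comment> \<open>If the alternating word had length at least \<open>m s t\<close>, the braid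
      relation would make it end in \<open>s\<close>, and \<open>w @ [s]\<close> would be shorter
      than \<open>w\<close>.\<close>
    have km: "k < m s t" if m0: "m s t \<noteq> 0"
    proof (rule ccontr)
      assume "\<not> k < m s t"
      then obtain j where j: "k = j + m s t" by (metis add.commute le_iff_add linorder_not_less)
      obtain l where l: "m s t = Suc l" using m0 by (cases "m s t") auto
      obtain y where y: "length y = j" "alt k s t = y @ alt (m s t) s t"
        using alt_split[of j "m s t" s t] j by auto
      have "w \<bumpeq> (v @ y) @ alt (m s t) s t" using v(1) y by simp
      also have "\<dots> \<bumpeq> (v @ y) @ alt (m s t) t s" by (rule append_cong[OF cox_eq.refl braid])
      also have "\<dots> = (v @ y @ alt l s t) @ [s]" unfolding l alt_snoc by simp
      finally have "w @ [s] \<bumpeq> (v @ y @ alt l s t) @ [s] @ [s]"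
        using append_cong[of w _ "[s]" "[s]"] by fastforce
      also have "\<dots> \<bumpeq> v @ y @ alt l s t" using cancel[of "v @ y @ alt l s t" s "[]"] by simp
      finally have "len (w @ [s]) \<le> length v + j + l" using len_le y(1) by fastforce
      then show False using less.prems v(2) j l by simp
    qed
    have "len v < len w" using len_le[of v v] v(2) \<open>1 \<le> k\<close> by simp
    then have pos: "0 \<le> act v (axis x 1) $ i" if "x \<in> {s, t}" for x
      using less.hyps lv that by blast
    obtain x y where xy: "0 \<le> x" "0 \<le> y"
      "cheb (m s t) 1 *\<^sub>R act (alt k s t) (axis s 1) = x *\<^sub>R axis s 1 + y *\<^sub>R axis t 1"
    proof -
      have nn: "0 \<le> cheb (m s t) k" "0 \<le> cheb (m s t) (Suc k)"
        using km cheb_nonneg[of s t k] cheb_nonneg[of s t "Suc k"] by fastforce+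
      have "cheb (m s t) 1 *\<^sub>R act (alt k s t) (axis s 1)
        = act (alt k s t) (cheb (m s t) (Suc 0) *\<^sub>R axis s 1 + cheb (m s t) 0 *\<^sub>R axis t 1)"
        by (simp add: linear_scale[OF linear_act])
      then show thesis
        using that[OF nn] that[OF nn(2,1)] act_alt[OF \<open>s \<noteq> t\<close>, of k 0]
        by (cases "even k") simp_all
    qed
    have "act w (axis s 1) = act v (act (alt k s t) (axis s 1))"
      using act_cong[OF v(1)] by simp
    then have "cheb (m s t) 1 *\<^sub>R act w (axis s 1) = act v (x *\<^sub>R axis s 1 + y *\<^sub>R axis t 1)"
      unfolding xy(3)[symmetric] by (simp add: linear_scale[OF linear_act])
    then have "cheb (m s t) 1 * act w (axis s 1) $ i
      = x * act v (axis s 1) $ i + y * act v (axis t 1) $ i"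
      by (simp add: linear_add[OF linear_act] linear_scale[OF linear_act] vec_eq_iff)
    moreover have "\<dots> \<ge> 0" using xy pos by simp
    ultimately show ?thesis
      using cheb_one_pos[OF \<open>s \<noteq> t\<close>] by (metis zero_le_mult_iff not_le)
  qed
qed

text \<open>If a reduced word starts with \<open>s\<close>, the inverse of the remaining word sends
  the simple root of \<open>s\<close> to a positive root. Dominance of \<open>y\<close> then gives
  \<open>y $ s \<le> 0\<close>, hence equality; so \<open>s\<close> fixes \<open>y\<close> and can
  be stripped off.\<close>

theorem stabilizer_parabolic:
  assumes dom: "\<And>i. 0 \<le> y $ i" and fixed: "dual_act w y = y"
  obtains w' where "w \<bumpeq> w'" "set w' \<subseteq> {i. y $ i = 0}"
proof -
  have "\<exists>w'. w \<bumpeq> w' \<and> set w' \<subseteq> {i. y $ i = 0}"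
    using fixed
  proof (induction "len w" arbitrary: w rule: less_induct)
    case less
    obtain w0 where w0: "w \<bumpeq> w0" "length w0 = len w" by (rule len_witness)
    show ?case
    proof (cases w0)
      case Nil
      with w0 show ?thesis by (intro exI[of _ "[]"]) auto
    next
      case (Cons s w1)
      have "len (rev w1) \<le> len (rev w1 @ [s])"
        using len_le[of w1 w1] len_cong[OF w0(1)] w0(2) Cons len_rev[of w1] len_rev[of "s # w1"] by simp
      then have "0 \<le> y \<bullet> act (rev w1) (axis s 1)"
        unfolding inner_vec_def using dom by (intro sum_nonneg) (simp add: root_nonneg)
      moreover have "y $ s = - (y \<bullet> act (rev w1) (axis s 1))"
      proof -
        have "y $ s = dual_act w0 y \<bullet> axis s 1"
          using less.prems dual_act_cong[OF w0(1)] by (simp add: inner_axis)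
        also have "\<dots> = y \<bullet> act (rev w1) (- axis s 1)"
          unfolding dual_act_inner Cons by simp
        finally show ?thesis by (simp add: linear_neg[OF linear_act])
      qed
      ultimately have ys: "y $ s = 0" using dom[of s] by simp
      have "dual_reflect s (dual_act w1 y) = y"
        using less.prems dual_act_cong[OF w0(1)] Cons by simp
      then have "dual_act w1 y = dual_reflect s y" by (metis dual_reflect_involution)
      then have "dual_act w1 y = y" by (simp add: dual_reflect_def ys)
      moreover have "len w1 < len w" using len_le[of w1 w1] w0(2) Cons by simp
      ultimately obtain w' where "w1 \<bumpeq> w'" "set w' \<subseteq> {i. y $ i = 0}"
        using less.hyps by blast
      then show ?thesis
        using w0(1) Cons ys append_cong[of "[s]" "[s]" w1 w'] by (intro exI[of _ "s # w'"]) (auto intro: cox_eq.trans)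
    qed
  qed
  then show thesis using that by blast
qed

section \<open>Even elements of a dihedral subgroup\<close>

lemma append_rev: "w @ rev w \<bumpeq> []"
proof (induction w)
  case (Cons i w)
  have "(i # w) @ rev (i # w) = [i] @ (w @ rev w) @ [i]" by simp
  also have "\<dots> \<bumpeq> [i] @ [] @ [i]" using Cons by (rule cox_context)
  also have "\<dots> \<bumpeq> []" using cancel[of "[]" i "[]"] by simp
  finally show ?case .
qed simp

text \<open>The exponent is a natural number, so the second word supplies the inverse
  rotations.\<close>

definition dihedral_power :: "'n \<Rightarrow> 'n \<Rightarrow> 'n list \<Rightarrow> bool" where
  "dihedral_power s t w \<longleftrightarrow> (\<exists>k. w \<bumpeq> concat (replicate k [s, t]) \<or> w \<bumpeq> concat (replicate k [t, s]))"

lemma dihedral_power_commute: "dihedral_power s t w \<longleftrightarrow> dihedral_power t s w"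
  unfolding dihedral_power_def by (simp only: disj_commute)

lemma dihedral_power_prepend:
  assumes "dihedral_power s t w"
  shows "dihedral_power s t ([s, t] @ w)"
proof -
  obtain k where "w \<bumpeq> concat (replicate k [s, t]) \<or> w \<bumpeq> concat (replicate k [t, s])"
    using assms unfolding dihedral_power_def by (elim exE)
  then show ?thesis
  proof
    assume w: "w \<bumpeq> concat (replicate k [s, t])"
    have "[s, t] @ w \<bumpeq> concat (replicate (Suc k) [s, t])"
      using append_cong[OF cox_eq.refl w, of "[s, t]"] by simp
    then show ?thesis unfolding dihedral_power_def by (intro exI disjI1)
  next
    assume w: "w \<bumpeq> concat (replicate k [t, s])"
    show ?thesis
    proof (cases k)
      case 0
      then have "[s, t] @ w \<bumpeq> concat (replicate (Suc 0) [s, t])"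
        using append_cong[OF cox_eq.refl w, of "[s, t]"] by simp
      then show ?thesis unfolding dihedral_power_def by (intro exI disjI1)
    next
      case (Suc l)
      have "[s, t] @ w \<bumpeq> [s, t] @ concat (replicate k [t, s])"
        using append_cong[OF cox_eq.refl w, of "[s, t]"] .
      also have "\<dots> = [s] @ t # t # s # concat (replicate l [t, s])" using Suc by simp
      also have "\<dots> \<bumpeq> [s] @ s # concat (replicate l [t, s])" by (rule cancel)
      also have "\<dots> = [] @ s # s # concat (replicate l [t, s])" by simp
      also have "\<dots> \<bumpeq> [] @ concat (replicate l [t, s])" by (rule cancel)
      finally have "[s, t] @ w \<bumpeq> concat (replicate l [t, s])" unfolding append_Nil .
      then show ?thesis unfolding dihedral_power_def by (intro exI disjI2)
    qed
  qed
qed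

lemma even_dihedral:
  assumes "even (length w)" "set w \<subseteq> {s, t}"
  shows "dihedral_power s t w"
  using assms
proof (induction w rule: induct_list012)
  case 1
  have "[] \<bumpeq> concat (replicate 0 [s, t])" by simp
  then show ?case unfolding dihedral_power_def by (intro exI disjI1)
next
  case (2 i)
  then show ?case by simp
next
  case (3 i j v)
  then have v: "dihedral_power s t v" by simp
  consider "i = j" | "i = s" "j = t" | "i = t" "j = s" using 3 by auto
  then show ?case
  proof cases
    case 1
    have "i # j # v \<bumpeq> v" using cancel[of "[]" i v] 1 by simp
    then show ?thesis using v unfolding dihedral_power_def
      by (elim exE disjE; intro exI) (rule disjI1 disjI2, erule (1) cox_eq.trans)+
  next
    case 2
    then show ?thesis using dihedral_power_prepend[OF v] by simp
  next
    case 3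
    then show ?thesis
      using dihedral_power_prepend[of t s v] v dihedral_power_commute[of s t] by simp
  qed
qed

end

section \<open>Galois conjugacy of primitive roots of unity\<close>

definition ipoly :: "int poly \<Rightarrow> complex \<Rightarrow> complex" where
  "ipoly P z = poly (map_poly of_int P) z"

lemma ipoly_0 [simp]: "ipoly 0 z = 0"
  by (simp add: ipoly_def)

lemma ipoly_pCons [simp]: "ipoly (pCons a P) z = of_int a + z * ipoly P z"
  by (simp add: ipoly_def map_poly_pCons)

lemma ipoly_add [simp]: "ipoly (P + Q) z = ipoly P z + ipoly Q z"
proof -
  have "map_poly of_int (P + Q) = (map_poly of_int P + map_poly of_int Q :: complex poly)"
    by (rule poly_eqI) (simp add: coeff_map_poly)
  then show ?thesis by (simp add: ipoly_def)
qed

lemma ipoly_smult [simp]: "ipoly (smult a P) z = of_int a * ipoly P z"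
  by (simp add: ipoly_def map_poly_smult)

lemma ipoly_mult [simp]: "ipoly (P * Q) z = ipoly P z * ipoly Q z"
  by (induction P) (simp_all add: algebra_simps)

lemma ipoly_uminus [simp]: "ipoly (- P) z = - ipoly P z"
  using ipoly_smult[of "- 1" P z] by simp

lemma ipoly_diff [simp]: "ipoly (P - Q) z = ipoly P z - ipoly Q z"
  using ipoly_add[of P "- Q" z] by simp

lemma ipoly_1 [simp]: "ipoly 1 z = 1"
  by (simp add: one_pCons)

lemma ipoly_power [simp]: "ipoly (P ^ k) z = ipoly P z ^ k"
  by (induction k) simp_all

lemma ipoly_monom [simp]: "ipoly (monom a k) z = of_int a * z ^ k"
  by (simp add: ipoly_def map_poly_monom poly_monom)

lemma ipoly_pcompose [simp]: "ipoly (P \<circ>\<^sub>p Q) z = ipoly P (ipoly Q z)"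
  by (induction P) (simp_all add: pcompose_pCons)

section \<open>Congruences modulo a prime\<close>

lemma prime_dvd_binomial_power:
  fixes x y :: "'a :: comm_ring_1"
  assumes "prime p"
  shows "of_nat p dvd (x + y) ^ p - (x ^ p + y ^ p)"
proof -
  have p: "0 < p" using assms by (simp add: prime_gt_0_nat)
  have *: "{..p} = insert 0 (insert p {0<..<p})" using p by auto
  then have "(x + y) ^ p = y ^ p + (x ^ p + (\<Sum>k\<in>{0<..<p}. of_nat (p choose k) * x ^ k * y ^ (p - k)))"
    unfolding binomial_ring * using p by simp
  moreover have "of_nat p dvd (of_nat (p choose k) :: 'a)" if "k \<in> {0<..<p}" for k
    using dvd_choose_prime[of k p] that assms by (auto simp: dvd_def)
  then have "of_nat p dvd (\<Sum>k\<in>{0<..<p}. of_nat (p choose k) * x ^ k * y ^ (p - k))"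
    by (intro dvd_sum dvd_mult2)
  ultimately show ?thesis by (simp add: algebra_simps)
qed

text \<open>Fermat's little theorem, with the binomial congruence as the induction step in both
  directions.\<close>

lemma prime_dvd_power_diff_self:
  assumes "prime p"
  shows "int p dvd a ^ p - a"
proof (induction a rule: int_induct[of _ 0])
  case base
  show ?case using prime_gt_0_nat[OF assms] by (simp add: power_0_left)
next
  case (step1 i)
  from dvd_add[OF prime_dvd_binomial_power[OF assms, of i 1] step1(2)] show ?case
    by (simp add: algebra_simps)
next
  case (step2 i)
  from dvd_diff[OF step2(2) prime_dvd_binomial_power[OF assms, of "i - 1" 1]] show ?case
    by (simp add: algebra_simps)
qed

text \<open>Modulo \<open>p\<close> the p-th power is a ring endomorphism that fixes the integers,
  so it acts on a polynomial only through the variable.\<close>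

lemma prime_dvd_pcompose_power:
  fixes f :: "int poly"
  assumes "prime p"
  shows "of_nat p dvd f ^ p - f \<circ>\<^sub>p monom 1 p"
proof (induction f)
  case 0
  show ?case using prime_gt_0_nat[OF assms] by (simp add: power_0_left)
next
  case (pCons a f)
  define x :: "int poly" where "x = [:0, 1:]"
  have e: "pCons a f = of_int a + x * f"
    by (simp add: x_def of_int_poly)
  have 1: "of_nat p dvd (pCons a f) ^ p - ((of_int a) ^ p + (x * f) ^ p)"
    unfolding e by (rule prime_dvd_binomial_power[OF assms])
  obtain k where "a ^ p - a = int p * k"
    using prime_dvd_power_diff_self[OF assms, of a] by (auto elim: dvdE)
  then have "of_int (a ^ p - a) = (of_nat p * of_int k :: int poly)" by (simp only: of_int_mult of_int_of_nat_eq)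
  then have 2: "of_nat p dvd (of_int (a ^ p - a) :: int poly)" by simp
  have 3: "of_nat p dvd x ^ p * (f ^ p - f \<circ>\<^sub>p monom 1 p)"
    using pCons.IH by (rule dvd_mult)
  have xp: "x ^ p = monom 1 p" by (simp add: x_def monom_altdef)
  have "pCons a f \<circ>\<^sub>p monom 1 p = of_int a + x ^ p * (f \<circ>\<^sub>p monom 1 p)"
    by (simp add: pcompose_pCons xp of_int_poly)
  then have "(pCons a f) ^ p - pCons a f \<circ>\<^sub>p monom 1 p
    = ((pCons a f) ^ p - ((of_int a) ^ p + (x * f) ^ p)) + (of_int (a ^ p - a)
      + x ^ p * (f ^ p - f \<circ>\<^sub>p monom 1 p))"
    by (simp add: algebra_simps power_mult_distrib)
  then show ?case using 1 2 3 by (metis dvd_add)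
qed

text \<open>Gauss's lemma: pseudo-division by a primitive \<open>g\<close> of least degree leaves no
  remainder, and the factor \<open>c\<close> that it introduces divides the content of the quotient.
  As \<open>g\<close> divides the monic \<open>h\<close>, its leading coefficient is a unit.\<close>

lemma integral_minimal_polynomial:
  assumes "lead_coeff h = 1" and "ipoly h z = 0"
  obtains f where "lead_coeff f = 1" "ipoly f z = 0" "\<And>P. ipoly P z = 0 \<Longrightarrow> f dvd P"
proof -
  define A where "A P \<longleftrightarrow> P \<noteq> 0 \<and> ipoly P z = 0" for P
  have "A h" using assms by (auto simp: A_def)
  then obtain g0 where "A g0" and min: "\<And>P. A P \<Longrightarrow> degree g0 \<le> degree P"
    by (metis ex_has_least_nat)
  define g where "g = primitive_part g0"
  have "ipoly g0 z = of_int (content g0) * ipoly g z"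
    unfolding g_def ipoly_smult[symmetric] by simp
  then have g: "g \<noteq> 0" "ipoly g z = 0" "content g = 1" "degree g = degree g0"
    using \<open>A g0\<close> by (auto simp: A_def g_def)
  have dvd: "g dvd P" if "ipoly P z = 0" for P
  proof -
    obtain q r where qr: "pseudo_divmod P g = (q, r)" by fastforce
    define c where "c = lead_coeff g ^ (Suc (degree P) - degree g)"
    have "c \<noteq> 0" unfolding c_def by (metis power_not_zero leading_coeff_0_iff g(1))
    have e: "smult c P = g * q + r" and d: "r = 0 \<or> degree r < degree g"
      using pseudo_divmod[OF g(1) qr] by (auto simp: c_def)
    have "ipoly r z = 0"
      using arg_cong[OF e, of "\<lambda>P. ipoly P z"] that g(2) by simp
    then have "r = 0" using min[of r] d g(4) unfolding A_def by (metis linorder_not_less)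
    then have eq: "smult c P = g * q" using e by simp
    then have "content q = content (smult c P)" using content_mult[of g q] g(3) by simp
    then have "c dvd content q" by simp
    then have "[:c:] dvd q" by (simp add: const_poly_dvd_iff_dvd_content)
    then obtain q' where "q = smult c q'" by (auto elim: dvdE)
    with eq have "smult c P = smult c (g * q')" by simp
    then have "smult c (P - g * q') = 0" by (simp add: smult_diff_right)
    then have "P = g * q'" using \<open>c \<noteq> 0\<close> by simp
    then show ?thesis by simp
  qed
  obtain k where "h = g * k" using dvd[OF assms(2)] by (auto elim: dvdE)
  then have "lead_coeff g * lead_coeff k = 1" using assms(1) by (simp add: lead_coeff_mult)
  then have u: "lead_coeff g = 1 \<or> lead_coeff g = - 1" by (auto simp: zmult_eq_1_iff)
  show thesis
  proof (rule that[of "smult (lead_coeff g) g"])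
    show "lead_coeff (smult (lead_coeff g) g) = 1" using u by auto
    show "smult (lead_coeff g) g dvd P" if "ipoly P z = 0" for P
      using u dvd[OF that] by auto
  qed (use g in simp)
qed

text \<open>With \<open>f\<close> the minimal polynomial of \<open>z\<close> and \<open>y = z ^ p\<close>: on the one hand \<open>f(y)\<close> is congruent to
  \<open>f(z) ^ p = 0\<close> modulo \<open>p\<close>; on the other hand, if \<open>f(y) \<noteq> 0\<close>, differentiating \<open>x ^ d - 1 = f k\<close> at
  \<open>y\<close> shows that \<open>f(y)\<close> divides \<open>d\<close>. So \<open>p\<close> divides \<open>d\<close> in \<open>\<int>[z]\<close>, hence in \<open>\<int>\<close>.\<close>

lemma ipoly_root_of_unity_prime_power:
  assumes z: "z ^ d = 1" and p: "prime p" "\<not> p dvd d" and P: "ipoly P z = 0" and d: "0 < d"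
  shows "ipoly P (z ^ p) = 0"
proof -
  define h :: "int poly" where "h = monom 1 d - 1"
  have deg: "degree h = d" "lead_coeff h = 1"
  proof -
    have *: "degree (- 1 :: int poly) < degree (monom (1::int) d)"
      using d by (simp add: degree_monom_eq)
    have "h = - 1 + monom 1 d" by (simp add: h_def)
    then show "degree h = d" "lead_coeff h = 1"
      using degree_add_eq_right[OF *] lead_coeff_add_le[OF *] by (simp_all add: degree_monom_eq)
  qed
  obtain f where f: "lead_coeff f = 1" "ipoly f z = 0" "\<And>P. ipoly P z = 0 \<Longrightarrow> f dvd P"
    using integral_minimal_polynomial[of h z] deg z by (auto simp: h_def)
  define y where "y = z ^ p"
  have y: "y ^ d = 1" by (metis y_def z power_mult mult.commute power_one)
  obtain k where k: "h = f * k" using f(3)[of h] z by (auto simp: h_def elim: dvdE)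
  have "ipoly f y = 0"
  proof (rule ccontr)
    assume ne: "ipoly f y \<noteq> 0"
    have "ipoly h y = 0" using y by (simp add: h_def)
    with ne have ky: "ipoly k y = 0" by (simp add: k)
    have "pderiv h = monom (int d) (d - 1)"
      by (simp add: h_def pderiv_diff pderiv_monom)
    then have "of_nat d * y ^ (d - 1) = ipoly (pderiv h) y" by simp
    also have "\<dots> = ipoly f y * ipoly (pderiv k) y"
      by (simp add: k pderiv_mult ky)
    finally have "of_nat d * y ^ d = ipoly f y * ipoly (pderiv k) y * y"
      using d by (cases d) (simp_all add: algebra_simps)
    then have dy: "of_nat d = ipoly f y * ipoly (pderiv k) y * y" using y by simp
    obtain G where G: "f ^ p - f \<circ>\<^sub>p monom 1 p = of_nat p * G"
      using prime_dvd_pcompose_power[OF p(1), of f] by (auto elim: dvdE)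
    have "- ipoly f y = of_nat p * ipoly G z"
      using arg_cong[OF G, of "\<lambda>P. ipoly P z"] f(2) prime_gt_0_nat[OF p(1)]
      by (simp add: y_def of_nat_poly power_0_left)
    then have fy: "ipoly f y = - of_nat p * ipoly G z" by (metis minus_minus mult_minus_left)
    \<comment> \<open>\<open>B\<close> collects the cofactors as one polynomial in \<open>z\<close>:
      composition with \<open>monom 1 p\<close> expresses values at \<open>y\<close> as values at
      \<open>z\<close>.\<close>
    define B where "B = - G * (pderiv k \<circ>\<^sub>p monom 1 p) * monom 1 p"
    have "of_nat d = of_nat p * ipoly B z"
      unfolding dy B_def fy by (simp add: y_def)
    then have "ipoly ([:int d:] - smult (int p) B) z = 0" by simp
    then obtain q where q: "[:int d:] - smult (int p) B = f * q" using f(3) by (metis dvdE)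
    have deg_f: "degree f \<noteq> 0"
    proof
      assume "degree f = 0"
      then obtain a where "f = [:a:]" by (rule degree_eq_zeroE)
      with f(1,2) show False by simp
    qed
    \<comment> \<open>As \<open>f\<close> is monic, the coefficients of \<open>q\<close> can be read
      off from those of \<open>f * q\<close> from the top down. Only indices from
      \<open>degree f > 0\<close> on are used, where the constant \<open>int d\<close> does not
      contribute.\<close>
    have cq: "int p dvd coeff q n" for n
    proof (induction "degree q - n" arbitrary: n rule: less_induct)
      case less
      show ?case
      proof (cases "n \<le> degree q")
        case True
        have "coeff (f * q) (degree f + n) = (\<Sum>i\<le>degree f + n. coeff f i * coeff q (degree f + n - i))"
          by (simp add: coeff_mult)
        also have "\<dots> = coeff q n + (\<Sum>i\<in>{..degree f + n} - {degree f}. coeff f i * coeff q (degree f + n - i))"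
          using f(1) by (subst sum.remove[of _ "degree f"]) auto
        finally have e: "coeff q n = coeff (f * q) (degree f + n)
          - (\<Sum>i\<in>{..degree f + n} - {degree f}. coeff f i * coeff q (degree f + n - i))" by simp
        have "int p dvd coeff (f * q) (degree f + n)"
          unfolding q[symmetric] using deg_f by (simp add: coeff_pCons split: nat.split)
        moreover have "int p dvd coeff f i * coeff q (degree f + n - i)"
          if "i \<in> {..degree f + n} - {degree f}" for i
        proof (cases "i < degree f")
          case i: True
          show ?thesis
          proof (cases "degree f + n - i \<le> degree q")
            case True
            then show ?thesis using i by (intro dvd_mult less.hyps) auto
          qed (simp add: coeff_eq_0)
        qed (use that in \<open>simp add: coeff_eq_0\<close>)
        ultimately show ?thesis unfolding e by (intro dvd_diff dvd_sum)
      qed (simp add: coeff_eq_0)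
    qed
    have "int d = coeff (f * q) 0 + int p * coeff B 0"
      unfolding q[symmetric] by simp
    also have "int p dvd \<dots>" using cq[of 0] by (simp add: coeff_mult)
    finally show False using p(2) by simp
  qed
  moreover have "f dvd P" using f(3) P .
  ultimately show ?thesis by (auto simp: y_def elim: dvdE)
qed

text \<open>The exponent is taken apart into primes; each step replaces \<open>z\<close> by
  \<open>z ^ p\<close>, which is again a d-th root of unity and a root of \<open>P\<close>.\<close>

lemma ipoly_root_of_unity_coprime_power:
  assumes z: "z ^ d = 1" and P: "ipoly P z = 0" and d: "0 < d" and k: "coprime k d" "0 < k"
  shows "ipoly P (z ^ k) = 0"
  using k z P
proof (induction k arbitrary: z rule: prime_divisors_induct)
  case (factor p k)
  have "p * k \<noteq> 0" using factor.prems by auto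
  have "\<not> p dvd d"
    using factor.prems factor.hyps by (metis coprime_common_divisor coprime_mult_left_iff dvd_refl not_prime_unit)
  then have "ipoly P (z ^ p) = 0"
    using ipoly_root_of_unity_prime_power[of z d p P] factor d by auto
  moreover have "(z ^ p) ^ d = 1" by (metis factor.prems(3) power_mult mult.commute power_one)
  ultimately have "ipoly P ((z ^ p) ^ k) = 0"
    using factor.IH[of "z ^ p"] factor.prems by (auto simp: coprime_mult_left_iff)
  then show ?case by (simp add: power_mult)
qed auto

lemma primitive_root_power_eq_1_iff:
  assumes "primitive_root_of_unity d z"
  shows "z ^ k = 1 \<longleftrightarrow> d dvd k"
proof -
  have d: "0 < d" "z ^ d = 1" and prim: "\<And>j. 0 < j \<Longrightarrow> j < d \<Longrightarrow> z ^ j \<noteq> 1"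
    using assms by (auto simp: primitive_root_of_unity_def)
  have "z ^ k = (z ^ d) ^ (k div d) * z ^ (k mod d)"
    by (metis mult_div_mod_eq power_add power_mult)
  then have "z ^ k = z ^ (k mod d)" using d by simp
  then show ?thesis using prim[of "k mod d"] d by (auto simp: dvd_eq_mod_eq_0)
qed

text \<open>By counting, the powers of \<open>z\<close> exhaust the d-th roots of unity, so
  \<open>w\<close> is one of them; its order makes the exponent coprime to \<open>d\<close>.\<close>

lemma ipoly_primitive_root_conjugate:
  assumes z: "primitive_root_of_unity d z" and w: "primitive_root_of_unity d w"
    and P: "ipoly P z = 0"
  shows "ipoly P w = 0"
proof -
  have d: "0 < d" "z ^ d = 1" "w ^ d = 1" using z w by (auto simp: primitive_root_of_unity_def)
  have inj: "inj_on (\<lambda>k. z ^ k) {..<d}"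
  proof (rule inj_onI)
    have *: "j = i" if "i \<le> j" "j < d" "z ^ i = z ^ j" for i j
    proof -
      have "z ^ j = z ^ i * z ^ (j - i)" by (subst power_add[symmetric]) (use that in simp)
      moreover have "z ^ i \<noteq> 0" using d by (metis power_0_left power_eq_0_iff zero_neq_one not_gr_zero)
      ultimately have "z ^ (j - i) = 1" using that by (metis mult_cancel_left mult.right_neutral)
      then show ?thesis using primitive_root_power_eq_1_iff[OF z] that
        by (metis diff_is_0_eq' dvd_imp_le le_neq_implies_less less_imp_diff_less linorder_not_le zero_less_diff)
    qed
    fix i j assume "i \<in> {..<d}" "j \<in> {..<d}" "z ^ i = z ^ j"
    then show "i = j" by (metis * lessThan_iff nat_le_linear)
  qed
  have "(\<lambda>k. z ^ k) ` {..<d} = {x. x ^ d = 1}"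
  proof (rule card_seteq)
    show "finite {x::complex. x ^ d = 1}" using d(1) by (intro finite_roots_unity) simp
    have "(z ^ k) ^ d = 1" for k by (metis d(2) power_mult mult.commute power_one)
    then show "(\<lambda>k. z ^ k) ` {..<d} \<subseteq> {x. x ^ d = 1}" by blast
    show "card {x::complex. x ^ d = 1} \<le> card ((\<lambda>k. z ^ k) ` {..<d})"
      using d(1) by (simp add: card_image[OF inj] card_roots_unity_eq)
  qed
  then obtain k where k: "w = z ^ k" using d(3) by blast
  have "coprime k d"
  proof (rule ccontr)
    define g where "g = gcd k d"
    assume "\<not> coprime k d"
    then have "1 < g" using d(1) by (metis coprime_iff_gcd_eq_1 g_def gcd_eq_0_iff less_one linorder_neqE_nat not_less_zero)
    obtain a b where ab: "k = g * a" "d = g * b" by (metis dvdE g_def gcd_dvd1 gcd_dvd2)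
    have "w ^ b = (z ^ d) ^ a" by (simp add: k ab mult_ac flip: power_mult)
    then have "w ^ b = 1" by (simp add: d(2))
    moreover have "0 < b" "b < d" using ab d(1) \<open>1 < g\<close> by auto
    ultimately show False using w by (auto simp: primitive_root_of_unity_def)
  qed
  show ?thesis
  proof (cases "k = 0")
    case True
    then have "d = 1" using \<open>coprime k d\<close> by simp
    then show ?thesis using d P by simp
  qed (use k d P \<open>coprime k d\<close> ipoly_root_of_unity_coprime_power in auto)
qed

section \<open>Triangle groups as groups of antiholomorphic reflections\<close>

definition mat2 :: "'a \<Rightarrow> 'a \<Rightarrow> 'a \<Rightarrow> 'a \<Rightarrow> 'a :: zero^2^2" where
  "mat2 a b c d = vector [vector [a, b], vector [c, d]]"

lemma mat2_nth [simp]: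
  "mat2 a b c d $ 1 $ 1 = a" "mat2 a b c d $ 1 $ 2 = b"
  "mat2 a b c d $ 2 $ 1 = c" "mat2 a b c d $ 2 $ 2 = d"
  by (simp_all add: mat2_def)

lemma mat2_eq_iff: "A = B \<longleftrightarrow> A$1$1 = B$1$1 \<and> A$1$2 = B$1$2 \<and> A$2$1 = B$2$1 \<and> A$2$2 = B$2$2"
  for A B :: "'a^2^2"
  by (auto simp: vec_eq_iff forall_2)

lemma mat2_inject [simp]: "mat2 a b c d = mat2 a' b' c' d' \<longleftrightarrow> a = a' \<and> b = b' \<and> c = c' \<and> d = d'"
  by (auto simp: mat2_eq_iff)

lemma mat2_cases: obtains a b c d where "A = mat2 a b c d"
  using that[of "A$1$1" "A$1$2" "A$2$1" "A$2$2"] by (simp add: mat2_eq_iff)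

lemma mat2_mult [simp]:
  fixes a b c d :: "'a :: semiring_1"
  shows "mat2 a b c d ** mat2 a' b' c' d'
    = mat2 (a * a' + b * c') (a * b' + b * d') (c * a' + d * c') (c * b' + d * d')"
  by (simp add: mat2_eq_iff matrix_matrix_mult_def sum_2)

lemma mat_eq_mat2: "mat k = mat2 k 0 0 k"
  by (simp add: mat2_eq_iff mat_def)

lemma uminus_mat2 [simp]: "- mat2 a b c d = mat2 (- a) (- b) (- c) (- d)" for a :: "'a :: ring_1"
  by (simp add: mat2_eq_iff)

lemma det_mat2 [simp]: "det (mat2 a b c d) = a * d - b * c" for a :: "'a :: comm_ring_1"
  by (simp add: det_2)

lemma map_matrix_mat2 [simp]: "map_matrix f (mat2 a b c d) = mat2 (f a) (f b) (f c) (f d)"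
  by (simp add: mat2_eq_iff map_matrix_def)

abbreviation cnj_mat :: "complex^2^2 \<Rightarrow> complex^2^2" where
  "cnj_mat \<equiv> map_matrix cnj"

lemma cnj_mat_mult [simp]: "cnj_mat (A ** B) = cnj_mat A ** cnj_mat B"
  by (cases A rule: mat2_cases, cases B rule: mat2_cases) simp

lemma cnj_mat_cnj_mat [simp]: "cnj_mat (cnj_mat A) = A"
  by (cases A rule: mat2_cases) simp

lemma cnj_mat_mat [simp]: "cnj_mat (mat c) = mat (cnj c)"
  by (simp add: mat_eq_mat2)

lemma mat_mult_commute: "A ** mat c = mat c ** A" for A :: "'a :: comm_semiring_1^2^2"
  by (cases A rule: mat2_cases) (simp add: mat_eq_mat2 mult.commute)

lemma mat_mult_mat: "mat a ** mat b = (mat (a * b) :: 'a :: semiring_1^2^2)"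
  by (simp add: mat_eq_mat2)

text \<open>The products 12, 23 and 13 have orders \<open>d\<close>, 2 and 3 and correspond to R, S
  and RS; \<open>d = 0\<close> belongs to the modular group itself.\<close>

definition tri :: "nat \<Rightarrow> 3 \<Rightarrow> 3 \<Rightarrow> nat" where
  "tri d i j = (if i = j then 1 else if i \<noteq> 3 \<and> j \<noteq> 3 then d else if i \<noteq> 2 \<and> j \<noteq> 2 then 3 else 2)"

lemma coxeter_tri: "d \<noteq> 1 \<Longrightarrow> coxeter (tri d)"
  by unfold_locales (auto simp: tri_def)

text \<open>A matrix \<open>M\<close> of this family stands for the antiholomorphic map \<open>w \<mapsto> M (cnj w)\<close>, which explains the
  conjugation in \<open>eval_word\<close>. The words \<open>[1, 2]\<close> and \<open>[2, 3]\<close> give \<^const>\<open>R_mat\<close> and \<^const>\<open>S_mat\<close>.\<close>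

definition refl_mat :: "complex \<Rightarrow> 3 \<Rightarrow> complex^2^2" where
  "refl_mat \<zeta> i = (if i = 1 then mat2 (- 1) 1 0 1 else if i = 2 then mat2 (- cnj \<zeta>) 0 0 1 else mat2 0 1 1 0)"

primrec eval_word :: "complex \<Rightarrow> 3 list \<Rightarrow> complex^2^2" where
  "eval_word \<zeta> [] = mat 1"
| "eval_word \<zeta> (i # w) = refl_mat \<zeta> i ** cnj_mat (eval_word \<zeta> w)"

lemma refl_mat_simps [simp]:
  "refl_mat \<zeta> 1 = mat2 (- 1) 1 0 1" "refl_mat \<zeta> 2 = mat2 (- cnj \<zeta>) 0 0 1" "refl_mat \<zeta> 3 = mat2 0 1 1 0"
  by (simp_all add: refl_mat_def)

lemma eval_word_append:
  "eval_word \<zeta> (u @ v) = eval_word \<zeta> u ** (if even (length u) then eval_word \<zeta> v else cnj_mat (eval_word \<zeta> v))"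
  by (induction u) (simp_all add: matrix_mul_assoc)

text \<open>\<open>refl_mat\<close> at \<open>\<zeta> = 1\<close>: the entries are real, so
  conjugation drops out and evaluation of words is multiplicative.\<close>

definition int_refl :: "3 \<Rightarrow> int^2^2" where
  "int_refl i = (if i = 1 then mat2 (- 1) 1 0 1 else if i = 2 then mat2 (- 1) 0 0 1 else mat2 0 1 1 0)"

primrec int_word :: "3 list \<Rightarrow> int^2^2" where
  "int_word [] = mat 1"
| "int_word (i # w) = int_refl i ** int_word w"

lemma int_refl_simps [simp]:
  "int_refl 1 = mat2 (- 1) 1 0 1" "int_refl 2 = mat2 (- 1) 0 0 1" "int_refl 3 = mat2 0 1 1 0"
  by (simp_all add: int_refl_def)

lemma int_word_append: "int_word (u @ v) = int_word u ** int_word v"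
  by (induction u) (simp_all add: matrix_mul_assoc)

lemma int_refl_square: "int_refl i ** int_refl i = mat 1"
  using exhaust_3[of i] by (auto simp: mat_eq_mat2)

lemma int_word_rev: "int_word w ** int_word (rev w) = mat 1"
proof (induction w)
  case (Cons i w)
  have "int_word (i # w) ** int_word (rev (i # w))
    = int_refl i ** (int_word w ** int_word (rev w)) ** int_refl i"
    by (simp add: int_word_append matrix_mul_assoc)
  then show ?case by (simp add: Cons int_refl_square)
qed simp

lemma int_word_rev': "int_word (rev w) ** int_word w = mat 1"
  using int_word_rev[of "rev w"] by simp

lemma det_int_word: "det (int_word w) = (- 1) ^ length w"
proof (induction w)
  case (Cons i w)
  have "det (int_refl i) = - 1" using exhaust_3[of i] by auto
  with Cons show ?case by (simp add: det_mul)
qed simp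

lemma eval_word_1: "eval_word 1 w = map_matrix of_int (int_word w)"
proof (induction w)
  case (Cons i w)
  then show ?case using exhaust_3[of i]
    by (cases "int_word w" rule: mat2_cases) auto
qed (simp add: mat_eq_mat2)

lemma det_eval_word: "\<zeta> \<noteq> 0 \<Longrightarrow> det (eval_word \<zeta> w) \<noteq> 0"
proof (induction w)
  case (Cons i w)
  have "det (refl_mat \<zeta> i) \<noteq> 0" using exhaust_3[of i] Cons.prems by auto
  moreover have "det (cnj_mat A) = cnj (det A)" for A
    by (cases A rule: mat2_cases) simp
  ultimately show ?case using Cons by (simp add: det_mul)
qed simp

definition proportional :: "complex^2^2 \<Rightarrow> complex^2^2 \<Rightarrow> bool" where
  "proportional A B \<longleftrightarrow> (\<exists>c. c \<noteq> 0 \<and> A = mat c ** B)"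

lemma proportional_refl: "proportional A A"
  unfolding proportional_def by (intro exI[of _ 1]) simp

lemma proportional_sym: "proportional A B \<Longrightarrow> proportional B A"
proof -
  assume "proportional A B"
  then obtain c where "c \<noteq> 0" "A = mat c ** B" unfolding proportional_def by blast
  then show ?thesis unfolding proportional_def
    by (intro exI[of _ "inverse c"]) (simp add: matrix_mul_assoc mat_mult_mat)
qed

lemma proportional_trans: "proportional A B \<Longrightarrow> proportional B C \<Longrightarrow> proportional A C"
  unfolding proportional_def by (metis matrix_mul_assoc mat_mult_mat mult_eq_0_iff)

text \<open>\<open>tri 0\<close> imposes no relation between the letters 1 and 2. The remaining
  relators evaluate to scalars for every unimodular \<open>\<zeta>\<close>.\<close>

lemma eval_word_tri_0:
  assumes "cnj \<zeta> * \<zeta> = 1" and "coxeter.cox_eq (tri 0) w w'"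
  shows "proportional (eval_word \<zeta> w) (eval_word \<zeta> w')"
proof -
  interpret coxeter "tri 0" by (rule coxeter_tri) simp
  have z: "\<zeta> * cnj \<zeta> = 1" using assms(1) by (simp add: mult.commute)
  have zz: "\<zeta> \<noteq> 0" using z by auto
  show ?thesis
    using assms(2)
  proof (induction rule: cox_eq.induct)
    case (rel u i j v)
    define x where "x = eval_word \<zeta> (concat (replicate (tri 0 i j) [i, j]))"
    have "\<exists>c. c \<noteq> 0 \<and> x = mat c"
      using exhaust_3[of i] exhaust_3[of j] assms(1) z zz
      by (auto simp: x_def tri_def numeral_3_eq_3 numeral_2_eq_2 mat_eq_mat2)
    then obtain c where c: "c \<noteq> 0" "x = mat c" by blast
    have ev: "even (length (concat (replicate (tri 0 i j) [i, j])))"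
      by (simp add: length_concat sum_list_replicate)
    have "eval_word \<zeta> (u @ concat (replicate (tri 0 i j) [i, j]) @ v)
      = eval_word \<zeta> u ** (if even (length u) then x ** eval_word \<zeta> v else cnj_mat (x ** eval_word \<zeta> v))"
      using ev by (simp add: eval_word_append x_def)
    \<comment> \<open>A scalar moved past an odd prefix is conjugated and stays nonzero.\<close>
    also have "\<dots> = mat (if even (length u) then c else cnj c) ** eval_word \<zeta> (u @ v)"
      by (simp add: c eval_word_append matrix_mul_assoc mat_mult_commute)
    finally show ?case using c(1) unfolding proportional_def by (metis complex_cnj_zero_iff)
  qed (blast intro: proportional_refl proportional_sym proportional_trans)+
qed

text \<open>The angle between the mirrors of 1 and 2; it is 0 for infinite order, where they meet in
  a cusp.\<close>

definition tri_angle :: "nat \<Rightarrow> real" where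
  "tri_angle d = (if d = 0 then 0 else pi / d)"

lemma cartan_tri:
  assumes "d \<noteq> 1"
  shows "coxeter.cartan (tri d) 1 = vector [2, - 2 * cos (tri_angle d), - 1]"
    "coxeter.cartan (tri d) 2 = vector [- 2 * cos (tri_angle d), 2, 0]"
    "coxeter.cartan (tri d) 3 = vector [- 1, 0, 2]"
proof -
  interpret coxeter "tri d" using assms by (rule coxeter_tri)
  show "cartan 1 = vector [2, - 2 * cos (tri_angle d), - 1]"
    "cartan 2 = vector [- 2 * cos (tri_angle d), 2, 0]"
    "cartan 3 = vector [- 1, 0, 2]"
    by (auto simp: vec_eq_iff forall_3 cartan_def tri_def tri_angle_def cos_60)
qed

text \<open>The coordinates are the values of minus the simple roots on the Hermitian matrix \<open>v v\<^sup>*\<close>,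
  \<open>v = (x, y)\<close>; \<open>tri_form\<close> is half of the invariant Hermitian form.\<close>

definition tri_vec :: "real \<Rightarrow> complex \<Rightarrow> complex \<Rightarrow> real^3" where
  "tri_vec \<theta> x y = vector [(cmod y)\<^sup>2 - 2 * Re (x * cnj y), 2 * Re (cis \<theta> * x * cnj y), (cmod x)\<^sup>2 - (cmod y)\<^sup>2]"

definition tri_form :: "real \<Rightarrow> complex \<Rightarrow> complex \<Rightarrow> real" where
  "tri_form \<theta> x y = sin \<theta> * ((cmod x)\<^sup>2 + (cmod y)\<^sup>2) - Im (cis \<theta> * x * cnj y)"

text \<open>A new letter acts on the first column alone, by conjugation followed by its matrix, so
  both claims reduce to one check per reflection. They start from the column (1, 0), whose
  coordinates are the fundamental weight of the letter 3.\<close>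

lemma eval_word_column:
  fixes d
  defines "\<theta> \<equiv> tri_angle d"
  assumes "d \<noteq> 1"
  shows "tri_vec \<theta> (eval_word (cis (2 * \<theta>)) w $ 1 $ 1) (eval_word (cis (2 * \<theta>)) w $ 2 $ 1)
      = foldr (coxeter.dual_reflect (tri d)) w (vector [0, 0, 1])"
    and "tri_form \<theta> (eval_word (cis (2 * \<theta>)) w $ 1 $ 1) (eval_word (cis (2 * \<theta>)) w $ 2 $ 1) = sin \<theta>"
proof -
  interpret coxeter "tri d" using assms by (intro coxeter_tri) simp
  note cartan = cartan_tri[OF \<open>d \<noteq> 1\<close>, folded \<theta>_def]
  define step where "step i x y = (let M = refl_mat (cis (2 * \<theta>)) i in
    (M $ 1 $ 1 * cnj x + M $ 1 $ 2 * cnj y, M $ 2 $ 1 * cnj x + M $ 2 $ 2 * cnj y))" for i x y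
  define e where "e = cis \<theta>"
  have e: "cis (2 * \<theta>) = e * e" "e * cnj e = 1" "cnj e * e = 1" "cmod e = 1" "Re e = cos \<theta>" "Im e = sin \<theta>"
    by (simp_all add: e_def cis_cnj cis_mult)
  have ee: "e * (cnj e * z) = z" "cnj e * (e * z) = z" for z
    using e by (simp_all flip: mult.assoc)
  have vec: "tri_vec \<theta> (fst (step i x y)) (snd (step i x y)) = dual_reflect i (tri_vec \<theta> x y)" for i x y
  proof -
    consider "i = 1" | "i = 2" | "i = 3" using exhaust_3 by blast
    then show ?thesis
    proof cases
      case 1
      show ?thesis
        by (simp add: 1 step_def tri_vec_def dual_reflect_def cartan vec_eq_iff forall_3 cmod_power2)
          (simp add: algebra_simps power2_eq_square)
    next
      case 2
      \<comment> \<open>The reflection sends \<open>u\<close> to \<open>- cnj u\<close>. The first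
        coordinate involves \<open>cnj e * u\<close>, and adding \<open>u\<close> and
        \<open>cnj u\<close> there produces the Cartan entry with
        \<open>cos \<theta>\<close>.\<close>
      define u where "u = e * (x * cnj y)"
      have u: "x * cnj y = cnj e * u" by (simp add: u_def ee)
      have "- cnj (cis (2 * \<theta>)) * cnj x * cnj (cnj y) = - (cnj e * cnj u)"
        unfolding e(1) by (simp add: u_def ee mult_ac)
      moreover have "cmod (- cnj (cis (2 * \<theta>)) * cnj x) = cmod x"
        by (simp only: norm_mult norm_minus_cancel complex_mod_cnj norm_cis mult_1)
      ultimately have "tri_vec \<theta> (- cnj (cis (2 * \<theta>)) * cnj x) (cnj y)
        = vector [(cmod y)\<^sup>2 + 2 * Re (cnj e * cnj u), - 2 * Re (cnj u), (cmod x)\<^sup>2 - (cmod y)\<^sup>2]"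
        unfolding tri_vec_def mult.assoc e_def[symmetric] by (simp add: ee) (simp add: algebra_simps)
      moreover have "tri_vec \<theta> x y
        = vector [(cmod y)\<^sup>2 - 2 * Re (cnj e * u), 2 * Re u, (cmod x)\<^sup>2 - (cmod y)\<^sup>2]"
        unfolding tri_vec_def mult.assoc e_def[symmetric] u by (simp add: ee)
      ultimately show ?thesis
        by (simp add: 2 step_def dual_reflect_def cartan vec_eq_iff forall_3)
          (simp add: e algebra_simps)
    next
      case 3
      show ?thesis
        by (simp add: 3 step_def tri_vec_def dual_reflect_def cartan vec_eq_iff forall_3 cmod_power2)
          (simp add: algebra_simps power2_eq_square)
    qed
  qed
  have form: "tri_form \<theta> (fst (step i x y)) (snd (step i x y)) = tri_form \<theta> x y" for i x y
  proof -
    consider "i = 1" | "i = 2" | "i = 3" using exhaust_3 by blast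
    then show ?thesis
    proof cases
      case 1
      show ?thesis
        by (simp add: 1 step_def tri_form_def cmod_power2)
          (simp add: algebra_simps power2_eq_square)
    next
      case 2
      have "cmod (- cnj (cis (2 * \<theta>)) * cnj x) = cmod x"
        by (simp only: norm_mult norm_minus_cancel complex_mod_cnj norm_cis mult_1)
      moreover have "cis \<theta> * (- cnj (cis (2 * \<theta>)) * cnj x) * cnj (cnj y) = - cnj (cis \<theta> * x * cnj y)"
        unfolding e_def[symmetric] e(1) by (simp add: ee mult_ac)
      ultimately have "tri_form \<theta> (- cnj (cis (2 * \<theta>)) * cnj x) (cnj y) = tri_form \<theta> x y"
        unfolding tri_form_def
        by (simp only: complex_mod_cnj uminus_complex.simps cnj.simps minus_minus)
      then show ?thesis by (simp add: 2 step_def)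
    next
      case 3
      show ?thesis
        by (simp add: 3 step_def tri_form_def cmod_power2)
          (simp add: algebra_simps power2_eq_square)
    qed
  qed
  define W where "W = eval_word (cis (2 * \<theta>))"
  have W: "(W (i # w) $ 1 $ 1, W (i # w) $ 2 $ 1) = step i (W w $ 1 $ 1) (W w $ 2 $ 1)" for i w
    by (simp add: W_def step_def Let_def matrix_matrix_mult_def sum_2 map_matrix_def)
  have "tri_vec \<theta> (W w $ 1 $ 1) (W w $ 2 $ 1) = foldr dual_reflect w (vector [0, 0, 1])
    \<and> tri_form \<theta> (W w $ 1 $ 1) (W w $ 2 $ 1) = sin \<theta>"
  proof (induction w)
    case Nil
    show ?case by (simp add: W_def mat_eq_mat2 tri_vec_def tri_form_def)
  next
    case (Cons i w)
    then show ?case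
      using vec[of i "W w $ 1 $ 1" "W w $ 2 $ 1"] form[of i "W w $ 1 $ 1" "W w $ 2 $ 1"]
      by (simp flip: W)
  qed
  then show "tri_vec \<theta> (eval_word (cis (2 * \<theta>)) w $ 1 $ 1) (eval_word (cis (2 * \<theta>)) w $ 2 $ 1)
      = foldr dual_reflect w (vector [0, 0, 1])"
    and "tri_form \<theta> (eval_word (cis (2 * \<theta>)) w $ 1 $ 1) (eval_word (cis (2 * \<theta>)) w $ 2 $ 1) = sin \<theta>"
    by (simp_all add: W_def)
qed

text \<open>For \<open>d \<noteq> 0\<close> the first column has unit length because infinity is not isotropic for the invariant
  form. For \<open>d = 0\<close> it is a cusp, and this has to be assumed.\<close>

lemma stabilizer_word:
  assumes d: "d \<noteq> 1" and "eval_word (cis (2 * tri_angle d)) w $ 2 $ 1 = 0"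
    and "d = 0 \<Longrightarrow> cmod (eval_word (cis (2 * tri_angle d)) w $ 1 $ 1) = 1"
  obtains w' where "coxeter.cox_eq (tri d) w w'" "set w' \<subseteq> {1, 2}"
proof -
  interpret coxeter "tri d" using d by (rule coxeter_tri)
  define a where "a = eval_word (cis (2 * tri_angle d)) w $ 1 $ 1"
  have "(cmod a)\<^sup>2 = 1"
  proof (cases "d = 0")
    case False
    have "sin (tri_angle d) * (cmod a)\<^sup>2 = sin (tri_angle d)"
      using eval_word_column(2)[OF d, of w] assms(2) by (simp add: tri_form_def a_def)
    moreover have "0 < sin (tri_angle d)"
      using False d by (auto simp: tri_angle_def field_simps intro!: sin_gt_zero)
    ultimately show ?thesis by simp
  qed (use assms(3) in \<open>simp add: a_def\<close>)
  then have "dual_act w (vector [0, 0, 1]) = vector [0, 0, 1]"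
    using eval_word_column(1)[OF d, of w] assms(2) by (simp add: tri_vec_def a_def)
  moreover have "0 \<le> (vector [0, 0, 1] :: real^3) $ i" for i
    using exhaust_3[of i] by auto
  ultimately obtain w' where "cox_eq w w'" "set w' \<subseteq> {i. (vector [0, 0, 1] :: real^3) $ i = 0}"
    using stabilizer_parabolic by blast
  moreover have "{i. (vector [0, 0, 1] :: real^3) $ i = 0} \<subseteq> {1, 2}"
    using exhaust_3 by fastforce
  ultimately show thesis using that by blast
qed

section \<open>The modular group and its representation\<close>

lemma SL2Z_simps [simp]: "carrier SL2Z = {A. det A = 1}" "A \<otimes>\<^bsub>SL2Z\<^esub> B = A ** B" "\<one>\<^bsub>SL2Z\<^esub> = mat 1"
  by (simp_all add: SL2Z_def)

lemma GL2C_simps [simp]: "carrier GL2C = {A. invertible A}" "A \<otimes>\<^bsub>GL2C\<^esub> B = A ** B" "\<one>\<^bsub>GL2C\<^esub> = mat 1"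
  by (simp_all add: GL2C_def)

lemma group_SL2Z: "group SL2Z"
proof (rule groupI)
  fix A assume "A \<in> carrier SL2Z"
  then show "\<exists>B\<in>carrier SL2Z. B \<otimes>\<^bsub>SL2Z\<^esub> A = \<one>\<^bsub>SL2Z\<^esub>"
    by (cases A rule: mat2_cases)
      (auto intro!: exI[of _ "mat2 (A$2$2) (- A$1$2) (- A$2$1) (A$1$1)"] simp: mat_eq_mat2 algebra_simps)
qed (auto simp: det_mul matrix_mul_assoc)

lemma group_GL2C: "group GL2C"
proof (rule groupI)
  fix A assume "A \<in> carrier GL2C"
  then show "\<exists>B\<in>carrier GL2C. B \<otimes>\<^bsub>GL2C\<^esub> A = \<one>\<^bsub>GL2C\<^esub>"
    by (auto simp: invertible_def)
qed (auto simp: matrix_mul_assoc invertible_det_nz det_mul)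

interpretation SL2Z: group SL2Z by (rule group_SL2Z)
interpretation GL2C: group GL2C by (rule group_GL2C)

lemma neg_one_mult: "- mat 1 ** A = - A" "A ** - mat 1 = - A" for A :: "int^2^2"
  by (cases A rule: mat2_cases, simp add: mat_eq_mat2)+

lemma det_neg_one: "det (- mat 1 :: int^2^2) = 1"
  by (simp add: mat_eq_mat2)

lemma normal_pm_one: "{mat 1, - mat 1} \<lhd> SL2Z"
proof (rule SL2Z.normalI)
  have inv: "inv\<^bsub>SL2Z\<^esub> (- mat 1) = - mat 1"
    by (rule SL2Z.inv_equality) (auto simp: neg_one_mult det_neg_one)
  show "subgroup {mat 1, - mat 1} SL2Z"
    by (rule SL2Z.subgroupI) (use inv SL2Z.inv_one in \<open>auto simp: neg_one_mult det_neg_one\<close>)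
  show "\<forall>A\<in>carrier SL2Z. {mat 1, - mat 1} #>\<^bsub>SL2Z\<^esub> A = A <#\<^bsub>SL2Z\<^esub> {mat 1, - mat 1}"
    by (auto simp: r_coset_def l_coset_def neg_one_mult)
qed

lemma mat_invertible: "c \<noteq> 0 \<Longrightarrow> invertible (mat c :: complex^2^2)"
  by (simp add: invertible_det_nz mat_eq_mat2)

lemma normal_scalars2C: "scalars2C \<lhd> GL2C"
proof (rule GL2C.normalI)
  have inv: "inv\<^bsub>GL2C\<^esub> (mat c) = mat (inverse c)" if "c \<noteq> 0" for c
    by (rule GL2C.inv_equality) (use that in \<open>auto simp: mat_mult_mat mat_invertible\<close>)
  show "subgroup scalars2C GL2C"
  proof (rule GL2C.subgroupI)
    show "scalars2C \<noteq> {}" unfolding scalars2C_def by (auto intro: exI[of _ 1])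
  qed (auto simp: scalars2C_def inv mat_mult_mat mat_invertible intro: exI)
  show "\<forall>A\<in>carrier GL2C. scalars2C #>\<^bsub>GL2C\<^esub> A = A <#\<^bsub>GL2C\<^esub> scalars2C"
    by (auto simp: r_coset_def l_coset_def scalars2C_def mat_mult_commute)
qed

lemma group_PSL2Z: "group PSL2Z"
  unfolding PSL2Z_def by (rule normal.factorgroup_is_group[OF normal_pm_one])

lemma group_PGL2C: "group PGL2C"
  unfolding PGL2C_def by (rule normal.factorgroup_is_group[OF normal_scalars2C])

interpretation PSL2Z: group PSL2Z by (rule group_PSL2Z)
interpretation PGL2C: group PGL2C by (rule group_PGL2C)

lemma psl_class_eq: "psl_class A = {A, - A}"
  by (auto simp: psl_class_def r_coset_def neg_one_mult)

lemma psl_class_eq_iff: "psl_class A = psl_class B \<longleftrightarrow> A = B \<or> A = - B"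
  by (auto simp: psl_class_eq doubleton_eq_iff)

lemma pgl_class_eq: "pgl_class A = {mat c ** A | c. c \<noteq> 0}"
  by (auto simp: pgl_class_def r_coset_def scalars2C_def)

lemma pgl_class_eqI: "proportional A B \<Longrightarrow> pgl_class A = pgl_class B"
proof -
  have "pgl_class A \<subseteq> pgl_class B" if AB: "proportional A B" for A B
  proof
    fix C assume "C \<in> pgl_class A"
    then have "proportional C A" by (auto simp: pgl_class_eq proportional_def)
    then have "proportional C B" using AB by (rule proportional_trans)
    then show "C \<in> pgl_class B" by (auto simp: pgl_class_eq proportional_def)
  qed
  then show "proportional A B \<Longrightarrow> pgl_class A = pgl_class B" by (blast dest: proportional_sym)
qed

lemma carrier_PSL2Z: "carrier PSL2Z = psl_class ` {A. det A = 1}"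
  by (simp add: PSL2Z_def carrier_FactGroup psl_class_def image_def)

lemma carrier_PGL2C: "carrier PGL2C = pgl_class ` {A. invertible A}"
  by (simp add: PGL2C_def carrier_FactGroup pgl_class_def image_def)

lemma psl_class_closed [simp]: "det A = 1 \<Longrightarrow> psl_class A \<in> carrier PSL2Z"
  by (auto simp: carrier_PSL2Z)

lemma psl_class_mult: "det A = 1 \<Longrightarrow> det B = 1 \<Longrightarrow> psl_class A \<otimes>\<^bsub>PSL2Z\<^esub> psl_class B = psl_class (A ** B)"
  using normal.rcos_sum[OF normal_pm_one, of A B] by (simp add: PSL2Z_def psl_class_def)

lemma pgl_class_mult:
  "invertible A \<Longrightarrow> invertible B \<Longrightarrow> pgl_class A \<otimes>\<^bsub>PGL2C\<^esub> pgl_class B = pgl_class (A ** B)"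
  using normal.rcos_sum[OF normal_scalars2C, of A B] by (simp add: PGL2C_def pgl_class_def)

lemma one_PSL2Z: "\<one>\<^bsub>PSL2Z\<^esub> = psl_class (mat 1)"
  by (simp add: PSL2Z_def psl_class_eq)

lemma one_PGL2C: "\<one>\<^bsub>PGL2C\<^esub> = pgl_class (mat 1)"
  by (simp add: PGL2C_def pgl_class_eq scalars2C_def)

lemma inv_psl_class:
  assumes "det A = 1" "A ** B = mat 1"
  shows "inv\<^bsub>PSL2Z\<^esub> (psl_class A) = psl_class B"
proof (rule PSL2Z.inv_unique'[symmetric])
  have B: "det B = 1" using assms det_mul[of A B] by simp
  have BA: "B ** A = mat 1"
    using assms SL2Z.inv_comm[of A B] B by simp
  show "psl_class A \<otimes>\<^bsub>PSL2Z\<^esub> psl_class B = \<one>\<^bsub>PSL2Z\<^esub>" "psl_class B \<otimes>\<^bsub>PSL2Z\<^esub> psl_class A = \<one>\<^bsub>PSL2Z\<^esub>"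
    using assms B BA by (simp_all add: psl_class_mult one_PSL2Z)
  show "psl_class A \<in> carrier PSL2Z" "psl_class B \<in> carrier PSL2Z" using assms B by simp_all
qed

lemma R_elt_eq: "R_elt = psl_class (mat2 1 1 0 1)"
  by (simp add: R_elt_def mat2_def)

lemma S_elt_eq: "S_elt = psl_class (mat2 0 (- 1) 1 0)"
  by (simp add: S_elt_def mat2_def)

lemma R_elt_closed [simp]: "R_elt \<in> carrier PSL2Z" and S_elt_closed [simp]: "S_elt \<in> carrier PSL2Z"
  by (simp_all add: R_elt_eq S_elt_eq)

lemma R_elt_pow: "R_elt [^]\<^bsub>PSL2Z\<^esub> (k::nat) = psl_class (mat2 1 (int k) 0 1)"
proof (induction k)
  case 0
  show ?case by (simp add: one_PSL2Z mat_eq_mat2)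
next
  case (Suc k)
  then show ?case by (simp add: R_elt_eq psl_class_mult)
qed

lemma translation_in_generate: "psl_class (mat2 1 q 0 1) \<in> generate PSL2Z {R_elt}"
proof -
  have pow: "psl_class (mat2 1 (int k) 0 1) \<in> generate PSL2Z {R_elt}" for k
  proof -
    have "R_elt [^]\<^bsub>PSL2Z\<^esub> k \<in> generate PSL2Z {R_elt}"
      by (induction k) (auto intro: generate.intros)
    then show ?thesis by (simp add: R_elt_pow)
  qed
  show ?thesis
  proof (cases "0 \<le> q")
    case True
    then show ?thesis using pow[of "nat q"] by simp
  next
    case False
    have "psl_class (mat2 1 q 0 1) = inv\<^bsub>PSL2Z\<^esub> psl_class (mat2 1 (int (nat (- q))) 0 1)"
      using False by (intro inv_psl_class[symmetric]) (simp_all add: mat_eq_mat2)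
    then show ?thesis
      using pow[of "nat (- q)"] by (simp add: PSL2Z.generate_m_inv_closed)
  qed
qed

text \<open>Euclid's algorithm on the first column: splitting off a translation and
  \<open>S_elt\<close> replaces the column (a, c) by (c, - (a mod c)).\<close>

lemma generate_PSL2Z: "generate PSL2Z {R_elt, S_elt} = carrier PSL2Z"
proof
  show "generate PSL2Z {R_elt, S_elt} \<subseteq> carrier PSL2Z"
    by (rule PSL2Z.generate_incl) auto
  have T: "psl_class (mat2 1 q 0 1) \<in> generate PSL2Z {R_elt, S_elt}" for q
    using translation_in_generate[of q] PSL2Z.mono_generate[of "{R_elt}" "{R_elt, S_elt}"] by auto
  have "psl_class A \<in> generate PSL2Z {R_elt, S_elt}" if "det A = 1" for A
    using that
  proof (induction "nat \<bar>A$2$1\<bar>" arbitrary: A rule: less_induct)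
    case less
    obtain a b c d where A: "A = mat2 a b c d" by (cases A rule: mat2_cases)
    have det: "a * d - b * c = 1" using less.prems A by simp
    show ?case
    proof (cases "c = 0")
      case True
      then have "a = 1 \<and> d = 1 \<or> a = - 1 \<and> d = - 1" using det by (simp add: zmult_eq_1_iff)
      then have "psl_class A = psl_class (mat2 1 (a * b) 0 1)"
        using True A by (auto simp: psl_class_eq_iff)
      then show ?thesis using T by simp
    next
      case False
      define q where "q = a div c"
      define B where "B = mat2 c d (- (a mod c)) (q * d - b)"
      have am: "a mod c = a - q * c" by (simp add: q_def minus_mult_div_eq_mod mult.commute)
      have B: "det B = 1" using det by (simp add: B_def am algebra_simps)
      have "A = mat2 1 q 0 1 ** (mat2 0 (- 1) 1 0 ** B)"
        by (simp add: A B_def am)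
      then have "psl_class A = psl_class (mat2 1 q 0 1) \<otimes>\<^bsub>PSL2Z\<^esub> (S_elt \<otimes>\<^bsub>PSL2Z\<^esub> psl_class B)"
        using B by (simp add: S_elt_eq psl_class_mult det_mul)
      moreover have "\<bar>a mod c\<bar> < \<bar>c\<bar>" using False by (rule abs_mod_less)
      then have "psl_class B \<in> generate PSL2Z {R_elt, S_elt}"
        using less.hyps[of B] B by (simp add: A B_def)
      ultimately show ?thesis using T[of q] by (auto intro!: generate.eng intro: generate.incl)
    qed
  qed
  then show "carrier PSL2Z \<subseteq> generate PSL2Z {R_elt, S_elt}" by (auto simp: carrier_PSL2Z)
qed

lemma det_even_word [simp]: "even (length w) \<Longrightarrow> det (int_word w) = 1"
  by (simp add: det_int_word)

text \<open>Both generators are words of length two, and inversion reverses a word because the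
  letters are involutions.\<close>

lemma even_word_representation:
  assumes "\<gamma> \<in> carrier PSL2Z"
  obtains w where "even (length w)" "\<gamma> = psl_class (int_word w)"
proof -
  have "\<gamma> \<in> generate PSL2Z {R_elt, S_elt}" using assms generate_PSL2Z by simp
  then have "\<exists>w. even (length w) \<and> \<gamma> = psl_class (int_word w)"
  proof (induction rule: generate.induct)
    case one
    show ?case by (intro exI[of _ "[]"]) (simp add: one_PSL2Z)
  next
    case (incl h)
    then consider "h = psl_class (int_word [1, 2])" | "h = psl_class (int_word [2, 3])"
      by (auto simp: R_elt_eq S_elt_eq mat_eq_mat2)
    then show ?case by cases (force intro: exI[of _ "[1, 2]"] exI[of _ "[2, 3]"])+
  next
    case (inv h)
    then consider "h = psl_class (int_word [1, 2])" | "h = psl_class (int_word [2, 3])"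
      by (auto simp: R_elt_eq S_elt_eq mat_eq_mat2)
    then obtain w where "even (length w)" "h = psl_class (int_word w)"
      by cases (force intro: that[of "[1, 2]"] that[of "[2, 3]"])+
    then have "inv\<^bsub>PSL2Z\<^esub> h = psl_class (int_word (rev w))"
      by (simp add: inv_psl_class int_word_rev)
    then show ?case using \<open>even (length w)\<close> by (intro exI[of _ "rev w"]) simp
  next
    case (eng h1 h2)
    then obtain u v where "even (length u)" "h1 = psl_class (int_word u)"
      "even (length v)" "h2 = psl_class (int_word v)" by blast
    then show ?case by (intro exI[of _ "u @ v"]) (simp add: psl_class_mult int_word_append)
  qed
  then show thesis using that by blast
qed

lemma int_word_translation:
  "int_word (concat (replicate k [1, 2])) = mat2 1 (int k) 0 1"
  "int_word (concat (replicate k [2, 1])) = mat2 1 (- int k) 0 1"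
  by (induction k) (simp_all add: mat_eq_mat2)

text \<open>For \<open>\<zeta> = 1\<close> the reflections have integer entries and generate \<open>PGL(2,\<int>)\<close>, so the theorem on
  stabilizers for \<open>d = 0\<close> turns an equation in \<^const>\<open>PSL2Z\<close> into a consequence of the Coxeter relations.\<close>

lemma eval_word_well_defined:
  assumes z: "cnj \<zeta> * \<zeta> = 1" and even: "even (length w)" "even (length w')"
    and eq: "psl_class (int_word w) = psl_class (int_word w')"
  shows "proportional (eval_word \<zeta> w) (eval_word \<zeta> w')"
proof -
  interpret coxeter "tri 0" by (rule coxeter_tri) simp
  define u where "u = rev w' @ w"
  have "int_word w = int_word w' \<or> int_word w = - int_word w'"
    using eq by (simp add: psl_class_eq_iff)
  then have "int_word u = mat 1 \<or> int_word u = - mat 1"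
  proof
    assume "int_word w = - int_word w'"
    then have "int_word u = int_word (rev w') ** (int_word w' ** - mat 1)"
      by (simp add: u_def int_word_append neg_one_mult)
    then show ?thesis by (simp add: matrix_mul_assoc int_word_rev')
  qed (simp add: u_def int_word_append int_word_rev')
  then have ev: "eval_word 1 u = mat2 1 0 0 1 \<or> eval_word 1 u = mat2 (- 1) 0 0 (- 1)"
    by (auto simp: eval_word_1 mat_eq_mat2)
  obtain u' where u': "cox_eq u u'" "set u' \<subseteq> {1, 2}"
  proof (rule stabilizer_word[of 0 u])
    show "eval_word (cis (2 * tri_angle 0)) u $ 2 $ 1 = 0"
      "cmod (eval_word (cis (2 * tri_angle 0)) u $ 1 $ 1) = 1"
      using ev by (auto simp: tri_angle_def)
  qed simp_all
  have "even (length u')" using parity[OF u'(1)] even by (simp add: u_def)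
  then have "dihedral_power 1 2 u'" using u'(2) by (rule even_dihedral)
  then obtain k where k: "cox_eq u (concat (replicate k [1, 2])) \<or> cox_eq u (concat (replicate k [2, 1]))"
    using u'(1) unfolding dihedral_power_def by (blast intro: cox_eq.trans)
  \<comment> \<open>The Coxeter relations may be evaluated at \<open>\<zeta> = 1\<close>, where
    \<open>u\<close> is scalar and the dihedral power is a translation by \<open>k\<close> or
    \<open>- k\<close>.\<close>
  have "k = 0"
  proof -
    have "eval_word 1 (concat (replicate k [1, 2])) = mat2 1 (of_nat k) 0 1"
      "eval_word 1 (concat (replicate k [2, 1])) = mat2 1 (- of_nat k) 0 1"
      by (simp_all only: eval_word_1 int_word_translation) simp_all
    then have "proportional (eval_word 1 u) (mat2 1 (of_nat k) 0 1)
      \<or> proportional (eval_word 1 u) (mat2 1 (- of_nat k) 0 1)"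
      using k eval_word_tri_0[of 1 u] by fastforce
    then show ?thesis using ev by (auto simp: proportional_def mat_eq_mat2)
  qed
  then have "cox_eq u []" using k by auto
  then have "cox_eq (w' @ u @ []) (w' @ [] @ [])" by (rule cox_context)
  then have 1: "cox_eq (w' @ rev w' @ w) w'" by (simp add: u_def)
  have "cox_eq ((w' @ rev w') @ w) ([] @ w)" by (rule append_cong[OF append_rev cox_eq.refl])
  then have "cox_eq w (w' @ rev w' @ w)" by (simp add: cox_eq.sym)
  then have "cox_eq w w'" using 1 by (rule cox_eq.trans)
  then show ?thesis by (rule eval_word_tri_0[OF z])
qed

lemma invertible_eval_word: "\<zeta> \<noteq> 0 \<Longrightarrow> invertible (eval_word \<zeta> w)"
  by (simp add: invertible_det_nz det_eval_word)

lemma rho_unique: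
  assumes "\<phi> \<in> hom PSL2Z PGL2C" "\<phi> \<in> extensional (carrier PSL2Z)"
    and "\<psi> \<in> hom PSL2Z PGL2C" "\<psi> \<in> extensional (carrier PSL2Z)"
    and R: "\<phi> R_elt = \<psi> R_elt" and S: "\<phi> S_elt = \<psi> S_elt"
  shows "\<phi> = \<psi>"
proof (rule extensionalityI[OF assms(2,4)])
  interpret \<phi>: group_hom PSL2Z PGL2C \<phi> by unfold_locales (rule assms(1))
  interpret \<psi>: group_hom PSL2Z PGL2C \<psi> by unfold_locales (rule assms(3))
  fix \<gamma> assume "\<gamma> \<in> carrier PSL2Z"
  then have "\<gamma> \<in> generate PSL2Z {R_elt, S_elt}" using generate_PSL2Z by simp
  then have "\<gamma> \<in> carrier PSL2Z \<and> \<phi> \<gamma> = \<psi> \<gamma>"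
    by (induction rule: generate.induct) (auto simp: R S)
  then show "\<phi> \<gamma> = \<psi> \<gamma>" ..
qed

text \<open>The definite description is resolved by exhibiting the map: each element is evaluated
  through a chosen even word, and other even words for it give proportional matrices. Unimodularity
  turns \<open>cnj \<zeta>\<close> into the inverse that occurs in \<open>S_mat\<close>.\<close>

lemma rho_eval_word:
  assumes z: "cnj \<zeta> * \<zeta> = 1"
  shows "rho \<zeta> \<in> hom PSL2Z PGL2C"
    and "even (length w) \<Longrightarrow> rho \<zeta> (psl_class (int_word w)) = pgl_class (eval_word \<zeta> w)"
proof -
  have "\<zeta> \<noteq> 0" using z by auto
  note inv = invertible_eval_word[OF this]
  define word where "word \<gamma> = (SOME w. even (length w) \<and> \<gamma> = psl_class (int_word w))" for \<gamma>
  have word: "even (length (word \<gamma>))" "\<gamma> = psl_class (int_word (word \<gamma>))" if "\<gamma> \<in> carrier PSL2Z" for \<gamma>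
  proof -
    obtain w where "even (length w) \<and> \<gamma> = psl_class (int_word w)"
      using even_word_representation[OF \<open>\<gamma> \<in> carrier PSL2Z\<close>] by blast
    then have "even (length (word \<gamma>)) \<and> \<gamma> = psl_class (int_word (word \<gamma>))"
      unfolding word_def by (rule someI)
    then show "even (length (word \<gamma>))" "\<gamma> = psl_class (int_word (word \<gamma>))" by blast+
  qed
  define \<phi> where "\<phi> = (\<lambda>\<gamma>\<in>carrier PSL2Z. pgl_class (eval_word \<zeta> (word \<gamma>)))"
  have \<phi>: "\<phi> (psl_class (int_word w)) = pgl_class (eval_word \<zeta> w)" if "even (length w)" for w
  proof -
    have c: "psl_class (int_word w) \<in> carrier PSL2Z" using that by simp
    have "proportional (eval_word \<zeta> (word (psl_class (int_word w)))) (eval_word \<zeta> w)"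
      using word[OF c] that by (intro eval_word_well_defined[OF z]) auto
    then show ?thesis using c by (simp add: \<phi>_def pgl_class_eqI)
  qed
  have hom: "\<phi> \<in> hom PSL2Z PGL2C"
  proof (rule homI)
    fix \<gamma> assume "\<gamma> \<in> carrier PSL2Z"
    then show "\<phi> \<gamma> \<in> carrier PGL2C" using inv by (auto simp: \<phi>_def carrier_PGL2C)
  next
    fix \<gamma> \<delta> assume "\<gamma> \<in> carrier PSL2Z" "\<delta> \<in> carrier PSL2Z"
    then obtain u v where u: "even (length u)" "\<gamma> = psl_class (int_word u)"
      and v: "even (length v)" "\<delta> = psl_class (int_word v)"
      using even_word_representation by metis
    have "\<phi> (\<gamma> \<otimes>\<^bsub>PSL2Z\<^esub> \<delta>) = \<phi> (psl_class (int_word (u @ v)))"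
      using u v by (simp add: psl_class_mult int_word_append)
    also have "\<dots> = pgl_class (eval_word \<zeta> u ** eval_word \<zeta> v)"
      using u v by (subst \<phi>) (simp_all add: eval_word_append)
    also have "\<dots> = \<phi> \<gamma> \<otimes>\<^bsub>PGL2C\<^esub> \<phi> \<delta>"
      using u v inv by (simp add: \<phi> pgl_class_mult)
    finally show "\<phi> (\<gamma> \<otimes>\<^bsub>PSL2Z\<^esub> \<delta>) = \<phi> \<gamma> \<otimes>\<^bsub>PGL2C\<^esub> \<phi> \<delta>" .
  qed
  have ext: "\<phi> \<in> extensional (carrier PSL2Z)" by (simp add: \<phi>_def)
  have R: "\<phi> R_elt = pgl_class (R_mat \<zeta>)"
  proof -
    have "R_elt = psl_class (int_word [1, 2])" by (simp add: R_elt_eq mat_eq_mat2)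
    moreover have "eval_word \<zeta> [1, 2] = R_mat \<zeta>"
      by (simp add: R_mat_def mat_eq_mat2 flip: mat2_def)
    ultimately show ?thesis using \<phi>[of "[1, 2]"] by simp
  qed
  have S: "\<phi> S_elt = pgl_class (S_mat \<zeta>)"
  proof -
    have "S_elt = psl_class (int_word [2, 3])" by (simp add: S_elt_eq mat_eq_mat2)
    moreover have "cnj \<zeta> = inverse \<zeta>" using z by (metis inverse_unique mult.commute)
    then have "eval_word \<zeta> [2, 3] = S_mat \<zeta>"
      by (simp add: S_mat_def mat_eq_mat2 flip: mat2_def)
    ultimately show ?thesis using \<phi>[of "[2, 3]"] by simp
  qed
  have "rho \<zeta> = \<phi>"
    unfolding rho_def
  proof (rule the_equality)
    show "\<phi> \<in> hom PSL2Z PGL2C \<and> \<phi> \<in> extensional (carrier PSL2Z) \<and>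
      \<phi> R_elt = pgl_class (R_mat \<zeta>) \<and> \<phi> S_elt = pgl_class (S_mat \<zeta>)"
      using hom ext R S by blast
    show "\<psi> = \<phi>" if "\<psi> \<in> hom PSL2Z PGL2C \<and> \<psi> \<in> extensional (carrier PSL2Z) \<and>
      \<psi> R_elt = pgl_class (R_mat \<zeta>) \<and> \<psi> S_elt = pgl_class (S_mat \<zeta>)" for \<psi>
      using that hom ext R S by (intro rho_unique) auto
  qed
  then show "rho \<zeta> \<in> hom PSL2Z PGL2C"
    and "even (length w) \<Longrightarrow> rho \<zeta> (psl_class (int_word w)) = pgl_class (eval_word \<zeta> w)"
    using hom \<phi> by simp_all
qed

lemma pgl_act_Infinity_iff: "pgl_act (pgl_class A) Infinity = Infinity \<longleftrightarrow> A $ 2 $ 1 = 0"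
proof -
  have "moebius (mat c ** A) Infinity = moebius A Infinity" if "c \<noteq> 0" for c
    using that by (cases A rule: mat2_cases) (simp add: mat_eq_mat2)
  then have "(\<lambda>c. moebius (mat c ** A) Infinity) ` {c. c \<noteq> 0} = (\<lambda>c. moebius A Infinity) ` {c::complex. c \<noteq> 0}"
    by (intro image_cong) auto
  also have "\<dots> = {moebius A Infinity}" by (rule image_constant[of 1]) simp
  also have "(\<lambda>c. moebius (mat c ** A) Infinity) ` {c. c \<noteq> 0} = (\<lambda>B. moebius B Infinity) ` pgl_class A"
    unfolding pgl_class_eq by blast
  finally have "(\<lambda>B. moebius B Infinity) ` pgl_class A = {moebius A Infinity}" .
  then show ?thesis by (simp add: pgl_act_def)
qed

section \<open>The stabilizer of infinity\<close>

lemma normal_closure_normal: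
  assumes "group G" "A \<subseteq> carrier G"
  shows "normal_closure G A \<lhd> G" and "A \<subseteq> normal_closure G A"
proof -
  interpret group G by fact
  define F where "F = {N. N \<lhd> G \<and> A \<subseteq> N}"
  have G: "carrier G \<in> F"
    using assms(2) normal_invI[OF subgroup_self] by (simp add: F_def)
  have sub: "subgroup (\<Inter>F) G"
    using G by (intro subgroups_Inter) (auto simp: F_def normal_imp_subgroup)
  show "normal_closure G A \<lhd> G"
    unfolding normal_closure_def F_def[symmetric]
  proof (rule normal_invI[OF sub])
    fix x h assume "x \<in> carrier G" "h \<in> \<Inter>F"
    then show "x \<otimes>\<^bsub>G\<^esub> h \<otimes>\<^bsub>G\<^esub> inv\<^bsub>G\<^esub> x \<in> \<Inter>F"
      by (auto simp: F_def intro: normal.inv_op_closed2)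
  qed
  show "A \<subseteq> normal_closure G A" by (auto simp: normal_closure_def)
qed

lemma normal_closure_least: "N \<lhd> G \<Longrightarrow> A \<subseteq> N \<Longrightarrow> normal_closure G A \<subseteq> N"
  by (auto simp: normal_closure_def)

lemma N_sub_normal: "N_sub d \<lhd> PSL2Z" and R_pow_in_N_sub: "R_elt [^]\<^bsub>PSL2Z\<^esub> d \<in> N_sub d"
  using normal_closure_normal[OF group_PSL2Z, of "{R_elt [^]\<^bsub>PSL2Z\<^esub> d}"] by (auto simp: N_sub_def)

text \<open>The preimage of \<open>N_sub d\<close> in SL(2,Z). At the level of matrices its elements
  can be multiplied with the values of odd words, which have determinant -1.\<close>

definition N_mat :: "nat \<Rightarrow> (int^2^2) set" where
  "N_mat d = {A. det A = 1 \<and> psl_class A \<in> N_sub d}"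

interpretation N_sub: normal "N_sub d" PSL2Z for d by (rule N_sub_normal)

lemma N_mat_one: "mat 1 \<in> N_mat d"
  by (simp add: N_mat_def flip: one_PSL2Z)

lemma N_mat_neg: "A \<in> N_mat d \<Longrightarrow> - A \<in> N_mat d"
  by (cases A rule: mat2_cases) (auto simp: N_mat_def psl_class_eq insert_commute)

lemma N_mat_mult: "A \<in> N_mat d \<Longrightarrow> B \<in> N_mat d \<Longrightarrow> A ** B \<in> N_mat d"
  by (auto simp: N_mat_def det_mul simp flip: psl_class_mult)

lemma N_mat_inverse: "A \<in> N_mat d \<Longrightarrow> A ** B = mat 1 \<Longrightarrow> B \<in> N_mat d"
  using det_mul[of A B] N_sub.m_inv_closed[of "psl_class A" d] inv_psl_class[of A B] by (auto simp: N_mat_def)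

lemma N_mat_conj:
  assumes A: "A \<in> N_mat d" and U: "det U = 1" "U ** V = mat 1"
  shows "U ** A ** V \<in> N_mat d"
proof -
  have V: "det V = 1" using U det_mul[of U V] by simp
  have "psl_class U \<otimes>\<^bsub>PSL2Z\<^esub> psl_class A \<otimes>\<^bsub>PSL2Z\<^esub> inv\<^bsub>PSL2Z\<^esub> (psl_class U) \<in> N_sub d"
    using A U by (intro N_sub.inv_op_closed2) (auto simp: N_mat_def)
  then show ?thesis
    using A U V by (simp add: N_mat_def inv_psl_class psl_class_mult det_mul)
qed

lemma translation_in_N_mat: "mat2 1 (int d) 0 1 \<in> N_mat d" "mat2 1 (- int d) 0 1 \<in> N_mat d"
proof -
  show 1: "mat2 1 (int d) 0 1 \<in> N_mat d"
    using R_pow_in_N_sub[of d] by (simp add: N_mat_def R_elt_pow)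
  show "mat2 1 (- int d) 0 1 \<in> N_mat d"
    by (rule N_mat_inverse[OF 1]) (simp add: mat_eq_mat2)
qed

lemma relation_in_N_mat: "int_word (concat (replicate (tri d i j) [i, j])) \<in> {mat 1, - mat 1, mat2 1 (int d) 0 1, mat2 1 (- int d) 0 1}"
  using exhaust_3[of i] exhaust_3[of j]
  by (elim disjE) (simp_all add: tri_def int_word_translation numeral_3_eq_3 numeral_2_eq_2 mat_eq_mat2)

text \<open>A relator inserted after the prefix \<open>u\<close> multiplies the value of the word
  from the left by a conjugate of the relator, and relators evaluate to plus or minus the identity
  or to translations by \<open>d\<close> or \<open>- d\<close>.\<close>

lemma int_word_cox_eq:
  assumes "d \<noteq> 1" "coxeter.cox_eq (tri d) w w'"
  shows "\<exists>B\<in>N_mat d. int_word w = B ** int_word w'"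
proof -
  interpret coxeter "tri d" using assms(1) by (rule coxeter_tri)
  show ?thesis
    using assms(2)
  proof (induction rule: cox_eq.induct)
    case (refl w)
    show ?case using N_mat_one by force
  next
    case (sym w w')
    then obtain B where B: "B \<in> N_mat d" "int_word w = B ** int_word w'" by blast
    have "invertible B" using B(1) unfolding N_mat_def
      by (metis (mono_tags, lifting) SL2Z.r_inv_ex SL2Z.l_inv_ex SL2Z_simps invertible_def mem_Collect_eq SL2Z.inv_comm)
    then obtain C where C: "B ** C = mat 1" "C ** B = mat 1" by (auto simp: invertible_def)
    then have "C \<in> N_mat d" "int_word w' = C ** int_word w"
      using N_mat_inverse[OF B(1)] B(2) by (simp_all add: matrix_mul_assoc)
    then show ?case by blast
  next
    case (trans u v w)
    then show ?case by (metis N_mat_mult matrix_mul_assoc)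
  next
    case (rel u i j v)
    define Z where "Z = int_word (concat (replicate (tri d i j) [i, j]))"
    have Z: "Z \<in> {mat 1, - mat 1, mat2 1 (int d) 0 1, mat2 1 (- int d) 0 1}"
      unfolding Z_def by (rule relation_in_N_mat)
    have "int_word u ** Z ** int_word (rev u) \<in> N_mat d"
    proof (cases "even (length u)")
      case True
      have "Z \<in> N_mat d"
        using Z translation_in_N_mat[of d] N_mat_one[of d] N_mat_neg[OF N_mat_one, of d] by auto
      then show ?thesis by (rule N_mat_conj) (use True in \<open>simp_all add: int_word_rev\<close>)
    next
      case False
      \<comment> \<open>A prefix of determinant -1 lies outside SL(2,Z). One more letter 2 corrects
        the determinant, and conjugation by it merely exchanges the two translations.\<close>
      define U where "U = int_word (u @ [2])"
      define Y where "Y = int_refl 2 ** Z ** int_refl 2"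
      have "int_refl 2 ** mat 1 ** int_refl 2 = mat 1" "int_refl 2 ** (- mat 1) ** int_refl 2 = - mat 1"
        "int_refl 2 ** mat2 1 (int d) 0 1 ** int_refl 2 = mat2 1 (- int d) 0 1"
        "int_refl 2 ** mat2 1 (- int d) 0 1 ** int_refl 2 = mat2 1 (int d) 0 1"
        by (simp_all add: mat_eq_mat2)
      then have "Y \<in> N_mat d"
        using Z translation_in_N_mat[of d] N_mat_one[of d] N_mat_neg[OF N_mat_one, of d]
        unfolding Y_def by auto
      then have "U ** Y ** int_word (rev (u @ [2])) \<in> N_mat d"
        by (rule N_mat_conj) (use False in \<open>simp_all add: U_def int_word_rev del: rev_append int_refl_simps\<close>)
      moreover have "U ** Y ** int_word (rev (u @ [2]))
        = int_word u ** (int_refl 2 ** int_refl 2) ** Z ** (int_refl 2 ** int_refl 2) ** int_word (rev u)"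
        by (simp add: U_def Y_def int_word_append matrix_mul_assoc del: int_refl_simps)
      ultimately show ?thesis by (simp only: int_refl_square matrix_mul_rid)
    qed
    moreover have "int_word (u @ concat (replicate (tri d i j) [i, j]) @ v)
      = (int_word u ** Z ** int_word (rev u)) ** int_word (u @ v)"
    proof -
      have "(int_word u ** Z ** int_word (rev u)) ** int_word (u @ v)
        = int_word u ** Z ** (int_word (rev u) ** int_word u) ** int_word v"
        by (simp only: int_word_append matrix_mul_assoc)
      then show ?thesis by (simp add: int_word_rev' int_word_append Z_def matrix_mul_assoc)
    qed
    ultimately show ?case by blast
  qed
qed

section \<open>Transfer between primitive roots of unity\<close>

lemma ipoly_cnj: "cnj (ipoly P z) = ipoly P (cnj z)"
  by (induction P) simp_all

text \<open>Conjugation is not polynomial, but on d-th roots of unity it is the power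
  \<open>d - 1\<close>, hence substitution of a monomial. The polynomial is chosen before
  \<open>\<zeta>\<close>, as it has to serve two conjugate roots.\<close>

lemma eval_word_ipoly:
  assumes "0 < d"
  shows "\<exists>P. \<forall>\<zeta>. \<zeta> ^ d = 1 \<longrightarrow> cnj \<zeta> * \<zeta> = 1 \<longrightarrow> eval_word \<zeta> w $ i $ j = ipoly P \<zeta>"
proof (induction w arbitrary: i j)
  case Nil
  have "(mat 1 :: complex^2^2) $ i $ j = ipoly (if i = j then 1 else 0) \<zeta>" for \<zeta>
    by (simp add: mat_def)
  then show ?case by auto
next
  case (Cons k w)
  have cnj_eq: "cnj \<zeta> = \<zeta> ^ (d - 1)" if "\<zeta> ^ d = 1" "cnj \<zeta> * \<zeta> = 1" for \<zeta>
  proof -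
    have "\<zeta> ^ (d - 1) * \<zeta> = cnj \<zeta> * \<zeta>"
      using that assms by (cases d) (simp_all add: mult.commute)
    moreover have "\<zeta> \<noteq> 0" using that by auto
    ultimately show ?thesis by simp
  qed
  have "\<exists>Q. \<forall>\<zeta>. \<zeta> ^ d = 1 \<longrightarrow> cnj \<zeta> * \<zeta> = 1 \<longrightarrow> refl_mat \<zeta> k $ i $ l = ipoly Q \<zeta>" for l
  proof -
    consider c where "\<And>\<zeta>. refl_mat \<zeta> k $ i $ l = of_int c" | "\<And>\<zeta>. refl_mat \<zeta> k $ i $ l = - cnj \<zeta>"
    proof -
      have "(\<exists>c. \<forall>\<zeta>. refl_mat \<zeta> k $ i $ l = of_int c) \<or> (\<forall>\<zeta>. refl_mat \<zeta> k $ i $ l = - cnj \<zeta>)"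
        using exhaust_3[of k] exhaust_2[of i] exhaust_2[of l]
        by (auto intro: exI[of _ 0] exI[of _ 1] exI[of _ "- 1"])
      then show thesis using that by blast
    qed
    then show ?thesis
    proof cases
      case 1
      then show ?thesis by (intro exI[of _ "[:c:]"]) simp
    next
      case 2
      then show ?thesis using cnj_eq by (intro exI[of _ "- monom 1 (d - 1)"]) simp
    qed
  qed
  then have "\<forall>l. \<exists>Q. \<forall>\<zeta>. \<zeta> ^ d = 1 \<longrightarrow> cnj \<zeta> * \<zeta> = 1 \<longrightarrow> refl_mat \<zeta> k $ i $ l = ipoly Q \<zeta>" ..
  from choice[OF this] obtain Q where
    Q: "\<And>l \<zeta>. \<zeta> ^ d = 1 \<Longrightarrow> cnj \<zeta> * \<zeta> = 1 \<Longrightarrow> refl_mat \<zeta> k $ i $ l = ipoly (Q l) \<zeta>" by blast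
  have "\<forall>l. \<exists>P. \<forall>\<zeta>. \<zeta> ^ d = 1 \<longrightarrow> cnj \<zeta> * \<zeta> = 1 \<longrightarrow> eval_word \<zeta> w $ l $ j = ipoly P \<zeta>"
    using Cons.IH ..
  from choice[OF this] obtain P where
    P: "\<And>l \<zeta>. \<zeta> ^ d = 1 \<Longrightarrow> cnj \<zeta> * \<zeta> = 1 \<Longrightarrow> eval_word \<zeta> w $ l $ j = ipoly (P l) \<zeta>" by blast
  have "eval_word \<zeta> (k # w) $ i $ j
    = ipoly (Q 1 * (P 1 \<circ>\<^sub>p monom 1 (d - 1)) + Q 2 * (P 2 \<circ>\<^sub>p monom 1 (d - 1))) \<zeta>"
    if z: "\<zeta> ^ d = 1" "cnj \<zeta> * \<zeta> = 1" for \<zeta>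
    by (simp add: matrix_matrix_mult_def sum_2 map_matrix_def Q[OF z] P[OF z] ipoly_cnj cnj_eq[OF z])
  then show ?case by blast
qed

lemma primitive_root_unit:
  assumes "primitive_root_of_unity d z"
  shows "cnj z * z = 1"
proof -
  have "cmod z = 1"
    using assms unfolding primitive_root_of_unity_def
    by (metis norm_ge_zero norm_one norm_power power_eq_1_iff)
  then show ?thesis by (metis complex_norm_square mult.commute of_real_1 one_power2)
qed

lemma cis_primitive_root:
  assumes "0 < d"
  shows "primitive_root_of_unity d (cis (2 * pi / d))"
  unfolding primitive_root_of_unity_def
proof (intro conjI allI impI)
  show "cis (2 * pi / d) ^ d = 1" using assms by (simp add: Complex.DeMoivre)
  fix k assume k: "0 < k \<and> k < d"
  have "cos (k * (2 * pi / d)) \<noteq> 1"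
  proof
    assume "cos (k * (2 * pi / d)) = 1"
    then obtain n :: int where "k * (2 * pi / d) = n * 2 * pi" by (auto simp: cos_one_2pi_int)
    then have "real k = n * real d" using assms by (simp add: field_simps)
    then have "int k = n * int d" by (metis of_int_eq_iff of_int_mult of_int_of_nat_eq)
    then have "d dvd k" by (metis dvd_triv_right int_dvd_int_iff)
    then show False using k by (auto dest: dvd_imp_le)
  qed
  then show "cis (2 * pi / d) ^ k \<noteq> 1" by (auto simp: Complex.DeMoivre complex_eq_iff)
qed (use assms in simp)

lemma stabilizer_Infinity:
  assumes d: "2 \<le> d" and z: "primitive_root_of_unity d \<zeta>"
    and w: "even (length w)" "eval_word \<zeta> w $ 2 $ 1 = 0"
  shows "psl_class (int_word w) \<in> N_sub d <#>\<^bsub>PSL2Z\<^esub> generate PSL2Z {R_elt}"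
proof -
  interpret coxeter "tri d" using d by (intro coxeter_tri) simp
  define z0 where "z0 = cis (2 * tri_angle d)"
  have z0: "primitive_root_of_unity d z0"
    using cis_primitive_root[of d] d by (simp add: z0_def tri_angle_def)
  obtain P where P: "\<And>\<zeta>. \<zeta> ^ d = 1 \<Longrightarrow> cnj \<zeta> * \<zeta> = 1 \<Longrightarrow> eval_word \<zeta> w $ 2 $ 1 = ipoly P \<zeta>"
    using eval_word_ipoly[of d w 2 1] d by auto
  have "ipoly P \<zeta> = 0"
    using P[of \<zeta>] z w primitive_root_unit[OF z] by (simp add: primitive_root_of_unity_def)
  then have "ipoly P z0 = 0" by (rule ipoly_primitive_root_conjugate[OF z z0])
  then have "eval_word z0 w $ 2 $ 1 = 0"
    using P[of z0] z0 primitive_root_unit[OF z0] by (simp add: primitive_root_of_unity_def)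
  then obtain w' where w': "cox_eq w w'" "set w' \<subseteq> {1, 2}"
    using stabilizer_word[of d w] d unfolding z0_def by auto
  have "even (length w')" using parity[OF w'(1)] w(1) by simp
  then have "dihedral_power 1 2 w'" using w'(2) by (rule even_dihedral)
  then obtain k where "cox_eq w (concat (replicate k [1, 2])) \<or> cox_eq w (concat (replicate k [2, 1]))"
    using w'(1) unfolding dihedral_power_def by (blast intro: cox_eq.trans)
  \<comment> \<open>The Coxeter relations are now read in the integer matrices and not through
    \<open>rho\<close>; this is what gives membership modulo \<open>N_sub d\<close> instead of
    modulo the kernel.\<close>
  then obtain q B where B: "B \<in> N_mat d" "int_word w = B ** mat2 1 q 0 1"
    using int_word_cox_eq[of d w] d int_word_translation by (metis one_less_numeral_iff not_less semiring_norm(76))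
  then have "psl_class (int_word w) = psl_class B \<otimes>\<^bsub>PSL2Z\<^esub> psl_class (mat2 1 q 0 1)"
    by (simp add: N_mat_def psl_class_mult)
  then show ?thesis
    using B(1) translation_in_generate[of q] by (auto simp: N_mat_def set_mult_def)
qed

theorem theorem3p2:
  fixes d :: nat and \<zeta> :: complex
  assumes "d \<ge> 2" and "primitive_root_of_unity d \<zeta>"
  shows "kernel PSL2Z PGL2C (rho \<zeta>) = N_sub d \<and>
         P_stab \<zeta> = generate PSL2Z {R_elt} <#>\<^bsub>PSL2Z\<^esub> N_sub d \<and>
         rho_bar \<zeta> \<in> mon (Delta d) PGL2C \<and>
         stabilizer (PGL2C\<lparr>carrier := rho_bar \<zeta> ` carrier (Delta d)\<rparr>) pgl_act Infinity
           = generate PGL2C {rho_bar \<zeta> (t_elt d)}"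
proof -
  have z: "cnj \<zeta> * \<zeta> = 1" by (rule primitive_root_unit[OF assms(2)])
  then have z0: "\<zeta> \<noteq> 0" by auto
  note rho = rho_eval_word[OF z]
  interpret group_hom PSL2Z PGL2C "rho \<zeta>" by unfold_locales (rule rho(1))
  let ?G = "generate PSL2Z {R_elt}"
  have gen_sub: "subgroup ?G PSL2Z" by (rule PSL2Z.generate_is_subgroup) simp
  have rho_R: "rho \<zeta> R_elt = pgl_class (mat2 \<zeta> 1 0 1)"
  proof -
    have "R_elt = psl_class (int_word [1, 2])" by (simp add: R_elt_eq mat_eq_mat2)
    then show ?thesis using rho(2)[of "[1, 2]"] by (simp add: mat_eq_mat2)
  qed
  have inv: "invertible (mat2 (\<zeta> ^ k) b 0 1)" for k b
    using z0 by (simp add: invertible_det_nz)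
  \<comment> \<open>\<open>b\<close> is a geometric sum. Its product with \<open>\<zeta> - 1\<close>
    suffices to see that it vanishes for \<open>k = d\<close>.\<close>
  have rho_R_pow: "\<exists>b. (\<zeta> - 1) * b = \<zeta> ^ k - 1 \<and> rho \<zeta> (R_elt [^]\<^bsub>PSL2Z\<^esub> k) = pgl_class (mat2 (\<zeta> ^ k) b 0 1)"
    for k :: nat
  proof (induction k)
    case 0
    show ?case by (intro exI[of _ 0]) (simp add: one_PGL2C mat_eq_mat2)
  next
    case (Suc k)
    then obtain b where b: "(\<zeta> - 1) * b = \<zeta> ^ k - 1"
      "rho \<zeta> (R_elt [^]\<^bsub>PSL2Z\<^esub> k) = pgl_class (mat2 (\<zeta> ^ k) b 0 1)" by blast
    have "rho \<zeta> (R_elt [^]\<^bsub>PSL2Z\<^esub> Suc k) = pgl_class (mat2 (\<zeta> ^ k) b 0 1 ** mat2 \<zeta> 1 0 1)"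
      using inv[of k b] inv[of 1 1] b(2) by (simp add: rho_R pgl_class_mult del: mat2_mult)
    moreover have "(\<zeta> - 1) * (\<zeta> ^ k + b) = \<zeta> ^ Suc k - 1"
      using b(1) by (simp add: algebra_simps)
    ultimately show ?case by (intro exI[of _ "\<zeta> ^ k + b"]) (simp add: mult.commute)
  qed
  have prim: "\<zeta> ^ k = 1 \<longleftrightarrow> d dvd k" for k by (rule primitive_root_power_eq_1_iff[OF assms(2)])
  have R_pow_d: "rho \<zeta> (R_elt [^]\<^bsub>PSL2Z\<^esub> d) = \<one>\<^bsub>PGL2C\<^esub>"
  proof -
    have "\<zeta> \<noteq> 1" using prim[of 1] assms(1) by auto
    then show ?thesis using rho_R_pow[of d] prim[of d] by (auto simp: one_PGL2C mat_eq_mat2)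
  qed
  have N_le: "N_sub d \<subseteq> kernel PSL2Z PGL2C (rho \<zeta>)"
    unfolding N_sub_def
    by (rule normal_closure_least[OF normal_kernel]) (simp add: kernel_def R_pow_d)
  have fix_iff: "pgl_act (rho \<zeta> (psl_class (int_word w))) Infinity = Infinity \<longleftrightarrow> eval_word \<zeta> w $ 2 $ 1 = 0"
    if "even (length w)" for w
    using that by (simp add: rho(2) pgl_act_Infinity_iff)
  \<comment> \<open>Multiples of \<open>d\<close> in the exponent are absorbed by
    \<open>N_sub d\<close>. The bound \<open>r < d\<close> is what later cuts the stabilizer down to
    the kernel.\<close>
  have G_decomp: "\<exists>r n. n \<in> N_sub d \<and> r < d \<and> g = n \<otimes>\<^bsub>PSL2Z\<^esub> R_elt [^]\<^bsub>PSL2Z\<^esub> (r::nat)" if g: "g \<in> ?G" for g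
  proof -
    obtain k :: int where k: "g = R_elt [^]\<^bsub>PSL2Z\<^esub> k"
      using g PSL2Z.generate_pow[of R_elt] by auto
    define r where "r = nat (k mod int d)"
    have r: "r < d" "int r = k mod int d" using assms(1) by (auto simp: r_def nat_less_iff)
    have "g = R_elt [^]\<^bsub>PSL2Z\<^esub> (int d * (k div int d) + int r)" using k r(2) by simp
    also have "\<dots> = (R_elt [^]\<^bsub>PSL2Z\<^esub> int d) [^]\<^bsub>PSL2Z\<^esub> (k div int d) \<otimes>\<^bsub>PSL2Z\<^esub> R_elt [^]\<^bsub>PSL2Z\<^esub> int r"
      by (simp only: PSL2Z.int_pow_mult[OF R_elt_closed] PSL2Z.int_pow_pow[OF R_elt_closed])
    also have "\<dots> = (R_elt [^]\<^bsub>PSL2Z\<^esub> d) [^]\<^bsub>PSL2Z\<^esub> (k div int d) \<otimes>\<^bsub>PSL2Z\<^esub> R_elt [^]\<^bsub>PSL2Z\<^esub> r"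
      by (simp only: int_pow_int)
    moreover have "(R_elt [^]\<^bsub>PSL2Z\<^esub> d) [^]\<^bsub>PSL2Z\<^esub> (k div int d) \<in> N_sub d"
      by (rule PSL2Z.subgroup_int_pow_closed[OF N_sub.subgroup_axioms R_pow_in_N_sub])
    ultimately show ?thesis using r(1) by blast
  qed
  have rho_N: "rho \<zeta> n = \<one>\<^bsub>PGL2C\<^esub>" if "n \<in> N_sub d" for n
    using N_le that by (auto simp: kernel_def)
  have comm: "N_sub d <#>\<^bsub>PSL2Z\<^esub> ?G = ?G <#>\<^bsub>PSL2Z\<^esub> N_sub d"
    using PSL2Z.commut_normal[OF gen_sub N_sub_normal] by simp
  have G_closed: "?G \<subseteq> carrier PSL2Z" using gen_sub by (rule subgroup.subset)
  have rho_G: "pgl_act (rho \<zeta> g) Infinity = Infinity" if g: "g \<in> ?G" for g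
  proof -
    obtain r n where rn: "n \<in> N_sub d" "g = n \<otimes>\<^bsub>PSL2Z\<^esub> R_elt [^]\<^bsub>PSL2Z\<^esub> (r::nat)"
      using G_decomp[OF g] by blast
    have "rho \<zeta> g = rho \<zeta> (R_elt [^]\<^bsub>PSL2Z\<^esub> r)"
      using rn N_sub.mem_carrier[OF rn(1)] by (simp add: rho_N)
    then show ?thesis using rho_R_pow[of r] by (auto simp: pgl_act_Infinity_iff)
  qed
  have stab: "P_stab \<zeta> = ?G <#>\<^bsub>PSL2Z\<^esub> N_sub d"
  proof
    show "P_stab \<zeta> \<subseteq> ?G <#>\<^bsub>PSL2Z\<^esub> N_sub d"
    proof
      fix \<gamma> assume "\<gamma> \<in> P_stab \<zeta>"
      then have \<gamma>: "\<gamma> \<in> carrier PSL2Z" "pgl_act (rho \<zeta> \<gamma>) Infinity = Infinity"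
        by (auto simp: P_stab_def stabilizer_def)
      obtain w where "even (length w)" "\<gamma> = psl_class (int_word w)"
        using \<gamma>(1) by (rule even_word_representation)
      then show "\<gamma> \<in> ?G <#>\<^bsub>PSL2Z\<^esub> N_sub d"
        using \<gamma>(2) stabilizer_Infinity[OF assms, of w] by (simp add: fix_iff comm)
    qed
    show "?G <#>\<^bsub>PSL2Z\<^esub> N_sub d \<subseteq> P_stab \<zeta>"
    proof
      fix \<gamma> assume "\<gamma> \<in> ?G <#>\<^bsub>PSL2Z\<^esub> N_sub d"
      then obtain g n where gn: "g \<in> ?G" "n \<in> N_sub d" "\<gamma> = g \<otimes>\<^bsub>PSL2Z\<^esub> n"
        unfolding set_mult_def by blast
      then have c: "g \<in> carrier PSL2Z" "n \<in> carrier PSL2Z"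
        using G_closed N_sub.mem_carrier by blast+
      then have "rho \<zeta> \<gamma> = rho \<zeta> g" using gn by (simp add: rho_N)
      then show "\<gamma> \<in> P_stab \<zeta>" using c gn rho_G by (simp add: P_stab_def stabilizer_def)
    qed
  qed
  have ker: "kernel PSL2Z PGL2C (rho \<zeta>) = N_sub d"
  proof
    show "kernel PSL2Z PGL2C (rho \<zeta>) \<subseteq> N_sub d"
    proof
      fix \<gamma> assume "\<gamma> \<in> kernel PSL2Z PGL2C (rho \<zeta>)"
      then have \<gamma>: "\<gamma> \<in> carrier PSL2Z" "rho \<zeta> \<gamma> = pgl_class (mat 1)"
        by (auto simp: kernel_def one_PGL2C)
      then have "\<gamma> \<in> P_stab \<zeta>"
        by (simp add: P_stab_def stabilizer_def pgl_act_Infinity_iff mat_eq_mat2)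
      then have "\<gamma> \<in> N_sub d <#>\<^bsub>PSL2Z\<^esub> ?G" by (simp only: stab comm)
      then obtain n g where ng: "n \<in> N_sub d" "g \<in> ?G" "\<gamma> = n \<otimes>\<^bsub>PSL2Z\<^esub> g"
        unfolding set_mult_def by blast
      obtain m r where mr: "m \<in> N_sub d" "r < d" "g = m \<otimes>\<^bsub>PSL2Z\<^esub> R_elt [^]\<^bsub>PSL2Z\<^esub> (r::nat)"
        using G_decomp[OF ng(2)] by blast
      define l where "l = n \<otimes>\<^bsub>PSL2Z\<^esub> m"
      have l: "l \<in> N_sub d" "\<gamma> = l \<otimes>\<^bsub>PSL2Z\<^esub> R_elt [^]\<^bsub>PSL2Z\<^esub> r"
        using ng mr N_sub.mem_carrier[OF ng(1)] N_sub.mem_carrier[OF mr(1)]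
        by (simp_all add: l_def PSL2Z.m_assoc)
      have lc: "l \<in> carrier PSL2Z" using l(1) by (rule N_sub.mem_carrier)
      then have "pgl_class (mat 1) = rho \<zeta> (R_elt [^]\<^bsub>PSL2Z\<^esub> r)" using \<gamma>(2) l by (simp add: rho_N)
      then obtain b where "pgl_class (mat 1) = pgl_class (mat2 (\<zeta> ^ r) b 0 1)" using rho_R_pow[of r] by auto
      moreover have "mat2 (\<zeta> ^ r) b 0 1 \<in> pgl_class (mat2 (\<zeta> ^ r) b 0 1)"
        unfolding pgl_class_eq by (auto intro: exI[of _ 1])
      ultimately have "mat2 (\<zeta> ^ r) b 0 1 \<in> pgl_class (mat 1)" by (simp only:)
      \<comment> \<open>A scalar matrix has equal diagonal entries, and the lower one is 1.\<close>
      then have "\<zeta> ^ r = 1" by (auto simp: pgl_class_eq mat_eq_mat2)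
      then have "r = 0" using prim[of r] mr(2) by (auto dest: dvd_imp_le)
      then show "\<gamma> \<in> N_sub d" using l lc by simp
    qed
  qed (rule N_le)
  have rho_bar: "rho_bar \<zeta> = (\<lambda>C. the_elem (rho \<zeta> ` C))" by (rule ext) (simp add: rho_bar_def)
  have mon: "rho_bar \<zeta> \<in> mon (Delta d) PGL2C"
    using FactGroup_hom FactGroup_inj_on unfolding mon_def Delta_def rho_bar ker by blast
  have rho_bar_coset: "rho_bar \<zeta> (N_sub d #>\<^bsub>PSL2Z\<^esub> \<gamma>) = rho \<zeta> \<gamma>" if "\<gamma> \<in> carrier PSL2Z" for \<gamma>
  proof -
    have "rho \<zeta> ` (N_sub d #>\<^bsub>PSL2Z\<^esub> \<gamma>) = (\<lambda>n. rho \<zeta> \<gamma>) ` N_sub d"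
      unfolding r_coset_def using that N_sub.mem_carrier by (force simp: rho_N)
    also have "\<dots> = {rho \<zeta> \<gamma>}" using N_sub.one_closed by (rule image_constant)
    finally show ?thesis by (simp add: rho_bar)
  qed
  have image: "rho_bar \<zeta> ` carrier (Delta d) = rho \<zeta> ` carrier PSL2Z"
    unfolding Delta_def carrier_FactGroup image_image by (rule image_cong) (simp_all add: rho_bar_coset)
  have "stabilizer (PGL2C\<lparr>carrier := rho_bar \<zeta> ` carrier (Delta d)\<rparr>) pgl_act Infinity = rho \<zeta> ` P_stab \<zeta>"
    unfolding image by (auto simp: stabilizer_def P_stab_def)
  also have "\<dots> = rho \<zeta> ` ?G"
  proof
    show "rho \<zeta> ` P_stab \<zeta> \<subseteq> rho \<zeta> ` ?G"
      unfolding stab set_mult_def using G_closed N_sub.mem_carrier by (force simp: rho_N)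
    show "rho \<zeta> ` ?G \<subseteq> rho \<zeta> ` P_stab \<zeta>"
      using rho_G G_closed by (auto simp: P_stab_def stabilizer_def)
  qed
  also have "\<dots> = generate PGL2C {rho_bar \<zeta> (t_elt d)}"
    using generate_img[of "{R_elt}"] by (simp add: t_elt_def rho_bar_coset)
  finally show ?thesis using ker stab mon by blast
qed

end
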